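(* There exist absolute constants $C_1,C_2,C_3>0$ such that the following holds for every $m\ge2$ and $\epsilon\in(0,1)$. There are an exponent $\alpha=\alpha(m,\epsilon)$ and a learning algorithm which, for every $n$ and every product distribution $\mathcal{D}=\times_{j=1}^n\mathcal{D}_j$ on weight matrices satisfying the small items assumption for the MinMax objective with $\zeta=C_1\frac{\log m}{\epsilon^2}$, draws at most $C_2\cdot\frac{m}{\log m}\cdot\log\frac{m}{\epsilon}$ independent instances from $\mathcal{D}$ and outputs, with high probability, a vector $\mathbf{w}\in\mathbb{R}_{>0}^m$ such that $$\mathbb{E}_{P\sim\mathcal{D}}\Big[\max_{i\in[m]}\ell_i(P,\alpha,\mathbf{w})\Big]\ \le\ (1+C_3\epsilon)\cdot T,\qquad T=\mathbb{E}_{P\sim\mathcal{D}}[\ell^{\mathrm{MKS}}(P)].$$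
   Context: There are $m$ agents and $n$ divisible items; an instance is a weight matrix $P=(p_{i,j})\in\mathbb{R}_{>0}^{m\times n}$. The $j$th column of $P$ is drawn independently from a discrete distribution $\mathcal{D}_j$ on $\mathbb{R}_{>0}^m$, so $P\sim\mathcal{D}=\times_j\mathcal{D}_j$. The learning algorithm has access to $\mathcal{D}$ only through independent samples $P\sim\mathcal{D}$. A feasible allocation is $X=(x_{i,j})\in[0,1]^{m\times n}$ with $\sum_i x_{i,j}=1$ for each $j$; loads are $\ell_i(P,X)=\sum_j p_{i,j}x_{i,j}$, and $\ell^{\mathrm{MKS}}(P)=\min_X\max_i\ell_i(P,X)$ is the optimal MinMax value. For $\alpha\in\mathbb{R}$ and $\mathbf{w}\in\mathbb{R}_{>0}^m$, $\ell_i(P,\alpha,\mathbf{w})$ is the load of agent $i$ under the (exponentiated) proportional allocation $x_{i,j}=p_{i,j}^\alpha w_i/\sum_{i'}p_{i',j}^\alpha w_{i'}$, where the exponent $\alpha$ is fixed in advance. Small items assumption with parameter $\zeta$ (for MinMax): with $T=\mathbb{E}_{P\sim\mathcal{D}}[\ell^{\mathrm{MKS}}(P)]$, every $P$ in the support of $\mathcal{D}$ satisfies $p_{i,j}\le T/\zeta$ for all $i\in[m],j\in[n]$. "With high probability" means with probability at least $1-1/m$ over the drawn samples (and any internal randomness). *)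

theory Defs
  imports "HOL-Probability.Probability" "HOL-Probability.Product_PMF"
begin

text \<open>
  Agents are \<open>i < m\<close>, items are \<open>j < n\<close>, and a weight matrix \<open>P\<close> has the entries \<open>P i j\<close>.
  Vectors indexed by the agents are extensional functions, so that they carry no data outside
  the index range.
\<close>

type_synonym weights = "nat \<Rightarrow> nat \<Rightarrow> real"

definition pos_vecs :: "nat \<Rightarrow> (nat \<Rightarrow> real) set" where
  "pos_vecs m = {..<m} \<rightarrow>\<^sub>E {0<..}"

definition feasible :: "nat \<Rightarrow> nat \<Rightarrow> weights set" where
  "feasible m n = {X. (\<forall>i<m. \<forall>j<n. X i j \<in> {0..1}) \<and> (\<forall>j<n. (\<Sum>i<m. X i j) = 1)}"

definition load :: "nat \<Rightarrow> weights \<Rightarrow> weights \<Rightarrow> nat \<Rightarrow> real" where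
  "load n P X i = (\<Sum>j<n. P i j * X i j)"

definition max_load :: "nat \<Rightarrow> nat \<Rightarrow> weights \<Rightarrow> weights \<Rightarrow> real" where
  "max_load m n P X = Max (load n P X ` {..<m})"

text \<open>
  For \<open>m \<ge> 1\<close> the infimum is a minimum: the objective is continuous in the finitely many
  relevant entries of \<open>X\<close>, which range over a nonempty compact set.
\<close>

definition opt_mks :: "nat \<Rightarrow> nat \<Rightarrow> weights \<Rightarrow> real" where
  "opt_mks m n P = (INF X\<in>feasible m n. max_load m n P X)"

definition prop_alloc :: "nat \<Rightarrow> weights \<Rightarrow> real \<Rightarrow> (nat \<Rightarrow> real) \<Rightarrow> weights" where
  "prop_alloc m P \<alpha> w i j = P i j powr \<alpha> * w i / (\<Sum>i'<m. P i' j powr \<alpha> * w i')"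

text \<open>
  \<open>D j\<close> is the distribution of the \<open>j\<close>-th column. The product is taken over the columns, and the
  resulting family of columns is transposed so that the entries read \<open>P i j\<close>.
\<close>

definition column_dists :: "nat \<Rightarrow> nat \<Rightarrow> (nat \<Rightarrow> (nat \<Rightarrow> real) pmf) set" where
  "column_dists m n = {D. \<forall>j<n. set_pmf (D j) \<subseteq> pos_vecs m}"

definition instance_pmf :: "nat \<Rightarrow> (nat \<Rightarrow> (nat \<Rightarrow> real) pmf) \<Rightarrow> weights pmf" where
  "instance_pmf n D = map_pmf (\<lambda>c i j. c j i) (Pi_pmf {..<n} (\<lambda>_. undefined) D)"

definition expected_opt :: "nat \<Rightarrow> nat \<Rightarrow> (nat \<Rightarrow> (nat \<Rightarrow> real) pmf) \<Rightarrow> real" where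
  "expected_opt m n D = measure_pmf.expectation (instance_pmf n D) (opt_mks m n)"

text \<open>
  The Bochner expectation of a non-integrable function is \<open>0\<close>. If the optimum is not integrable
  and \<open>m, n \<ge> 1\<close>, the following assumption therefore fails, as all weights are positive. If it
  holds with \<open>\<zeta> > 0\<close>, all weights are bounded, and so are all loads of feasible allocations.
\<close>

definition small_items :: "nat \<Rightarrow> nat \<Rightarrow> (nat \<Rightarrow> (nat \<Rightarrow> real) pmf) \<Rightarrow> real \<Rightarrow> bool" where
  "small_items m n D \<zeta> \<longleftrightarrow>
     (\<forall>P\<in>set_pmf (instance_pmf n D). \<forall>i<m. \<forall>j<n. P i j \<le> expected_opt m n D / \<zeta>)"

text \<open>
  A learning algorithm is given the number of items and a list of sampled weight matrices, and
  returns a distribution over output vectors, which accounts for its internal randomness. The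
  distribution below is that of its output on \<open>N\<close> independent samples from the product of \<open>D\<close>.
\<close>

type_synonym learner = "nat \<Rightarrow> weights list \<Rightarrow> (nat \<Rightarrow> real) pmf"

definition learner_output ::
  "learner \<Rightarrow> nat \<Rightarrow> nat \<Rightarrow> (nat \<Rightarrow> (nat \<Rightarrow> real) pmf) \<Rightarrow> (nat \<Rightarrow> real) pmf" where
  "learner_output A N n D = bind_pmf (replicate_pmf N (instance_pmf n D)) (A n)"

end

theory Submission
  imports Defs
begin

text \<open>
  For dual multipliers \<open>y\<close> in the simplex, the expected sum over the items of the \<open>\<beta>\<close>-softmin of
  \<open>y i * P i j\<close> is at most \<open>T\<close> by weak duality. Its partial derivatives dominate, up to the factor
  \<open>m powr (1 / \<beta>)\<close>, the expected loads of the proportional allocation with exponent \<open>- (\<beta> + 1)\<close> and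
  weights \<open>y i powr - (\<beta> + 1)\<close>. As the softmin is homogeneous and concave, at a near-maximiser over a
  slightly truncated simplex no partial derivative is much larger than \<open>T\<close>; with
  \<open>\<beta> = ln m / \<epsilon>\<close> all expected loads are then at most \<open>(1 + O(\<epsilon>)) T\<close>. The truncation keeps the
  weights in a range that a net of \<open>(m / \<epsilon>) ^ O(m)\<close> vectors covers.

  Over \<open>N\<close> samples the empirical loads are sums of \<open>N n\<close> independent small terms, so each of them
  deviates from its mean with probability at most \<open>exp (- N ln m)\<close>, and \<open>N ln m\<close> of order
  \<open>m ln (m / \<epsilon>)\<close> pays for a union bound over the net. The learner minimises the largest empirical
  load over the net. Finally, the same moment generating function shows that on a fresh instance
  the expected maximum of the loads exceeds the maximum of their expectations by a factor and a
  term of order \<open>\<epsilon>\<close> only.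
\<close>

section \<open>Moment generating functions and tail bounds\<close>

lemma integrable_pmf_bounded:
  fixes f :: "'a \<Rightarrow> real"
  assumes "\<And>x. x \<in> set_pmf p \<Longrightarrow> \<bar>f x\<bar> \<le> B"
  shows "integrable (measure_pmf p) f"
  using assms by (intro measure_pmf.integrable_const_bound[where B = B]) (auto simp: AE_measure_pmf_iff)

lemma expectation_pmf_mono:
  fixes f g :: "'a \<Rightarrow> real"
  assumes "integrable (measure_pmf p) f" "integrable (measure_pmf p) g"
    and "\<And>x. x \<in> set_pmf p \<Longrightarrow> f x \<le> g x"
  shows "measure_pmf.expectation p f \<le> measure_pmf.expectation p g"
  using assms by (intro integral_mono_AE) (auto simp: AE_measure_pmf_iff)

text \<open>Convexity of exp between the endpoints 0 and \<open>b\<close>. The chord is affine in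
  \<open>x\<close>, so after taking expectations only the mean of \<open>x\<close> enters.\<close>

lemma exp_le_chord:
  fixes x b c :: real
  assumes "0 \<le> x" "x \<le> b" "0 < b"
  shows "exp (c * x) \<le> 1 + (exp (c * b) - 1) / b * x"
proof -
  have eq: "(1 - x / b) *\<^sub>R 0 + (x / b) *\<^sub>R (c * b) = c * x"
    using assms by simp
  have "exp ((1 - x / b) *\<^sub>R 0 + (x / b) *\<^sub>R (c * b)) \<le> (1 - x / b) * exp 0 + (x / b) * exp (c * b)"
    using assms by (intro convex_onD[OF exp_convex]) auto
  also have "(1 - x / b) * exp 0 + (x / b) * exp (c * b) = 1 + (exp (c * b) - 1) / b * x"
    using assms by (simp add: field_simps)
  finally show ?thesis
    unfolding eq .
qed

lemma exp_sub_one_le: "exp x - 1 \<le> x * exp (x :: real)"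
proof -
  have "(1 - x) * exp x \<le> exp (- x) * exp x"
    using exp_ge_add_one_self[of "- x"] by (intro mult_right_mono) auto
  then show ?thesis by (simp add: algebra_simps flip: exp_add)
qed

lemma exp_mult_le_affine:
  fixes c \<epsilon> :: real
  assumes "0 \<le> \<epsilon>" "\<epsilon> \<le> 1" 
  shows "exp (c * \<epsilon>) \<le> 1 + exp c * \<epsilon>"
proof -
  have "exp (c * \<epsilon>) \<le> 1 + (exp c - 1) * \<epsilon>"
    using exp_le_chord[of \<epsilon> 1 c] assms by simp
  also have "\<dots> \<le> 1 + exp c * \<epsilon>"
    using assms by (simp add: algebra_simps)
  finally show ?thesis .
qed

text \<open>Independence factors the expectation; each factor is bounded by the chord and then by 1
  + z \<le> exp z. The sign of \<open>c\<close> is free, so upper and lower tails both follow from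
  this bound.\<close>

lemma mgf_Pi_pmf_le:
  fixes f :: "'a \<Rightarrow> 'b \<Rightarrow> real" and b c :: real
  assumes "finite A" "0 < b"
    and bounds: "\<And>x v. x \<in> A \<Longrightarrow> v \<in> set_pmf (p x) \<Longrightarrow> 0 \<le> f x v \<and> f x v \<le> b"
  shows "measure_pmf.expectation (Pi_pmf A d p) (\<lambda>y. exp (c * (\<Sum>x\<in>A. f x (y x))))
    \<le> exp ((exp (c * b) - 1) / b * measure_pmf.expectation (Pi_pmf A d p) (\<lambda>y. \<Sum>x\<in>A. f x (y x)))"
proof -
  let ?k = "(exp (c * b) - 1) / b"
  have integrable_f: "integrable (measure_pmf (p x)) (f x)" if "x \<in> A" for x
    using bounds[OF that] by (intro integrable_pmf_bounded[where B = b]) fastforce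
  have integrable_exp: "integrable (measure_pmf (p x)) (\<lambda>v. exp (c * f x v))" if "x \<in> A" for x
  proof (rule integrable_pmf_bounded[where B = "exp (\<bar>c\<bar> * b)"])
    fix v assume "v \<in> set_pmf (p x)"
    with bounds[OF that] have "0 \<le> f x v" "f x v \<le> b" by auto
    then have "c * f x v \<le> \<bar>c\<bar> * b"
      by (intro mult_mono) auto
    then show "\<bar>exp (c * f x v)\<bar> \<le> exp (\<bar>c\<bar> * b)" by simp
  qed
  have marginal: "map_pmf (\<lambda>y. y x) (Pi_pmf A d p) = p x" if "x \<in> A" for x
    using Pi_pmf_component[OF \<open>finite A\<close>, of x d p] that by simp
  have component: "measure_pmf.expectation (Pi_pmf A d p) (\<lambda>y. f x (y x)) = measure_pmf.expectation (p x) (f x)"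
    if "x \<in> A" for x
    by (subst marginal[OF that, symmetric]) simp
  have integrable_component: "integrable (measure_pmf (Pi_pmf A d p)) (\<lambda>y. f x (y x))" if "x \<in> A" for x
    using integrable_f[OF that] by (subst (asm) marginal[OF that, symmetric]) simp
  have "measure_pmf.expectation (Pi_pmf A d p) (\<lambda>y. exp (c * (\<Sum>x\<in>A. f x (y x))))
      = measure_pmf.expectation (Pi_pmf A d p) (\<lambda>y. \<Prod>x\<in>A. exp (c * f x (y x)))"
    using \<open>finite A\<close> by (simp add: exp_sum sum_distrib_left)
  also have "\<dots> = (\<Prod>x\<in>A. measure_pmf.expectation (p x) (\<lambda>v. exp (c * f x v)))"
    using assms integrable_exp by (intro expectation_prod_Pi_pmf) auto
  also have "\<dots> \<le> (\<Prod>x\<in>A. exp (?k * measure_pmf.expectation (p x) (f x)))"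
  proof (intro prod_mono conjI)
    fix x assume "x \<in> A"
    show "0 \<le> measure_pmf.expectation (p x) (\<lambda>v. exp (c * f x v))" by simp
    have "measure_pmf.expectation (p x) (\<lambda>v. exp (c * f x v))
        \<le> measure_pmf.expectation (p x) (\<lambda>v. 1 + ?k * f x v)"
      using integrable_f[OF \<open>x \<in> A\<close>] integrable_exp[OF \<open>x \<in> A\<close>] bounds[OF \<open>x \<in> A\<close>] \<open>0 < b\<close>
      by (intro expectation_pmf_mono exp_le_chord) auto
    also have "\<dots> = 1 + ?k * measure_pmf.expectation (p x) (f x)"
      using integrable_f[OF \<open>x \<in> A\<close>] by simp
    also have "\<dots> \<le> exp (?k * measure_pmf.expectation (p x) (f x))"
      by (rule exp_ge_add_one_self)
    finally show "measure_pmf.expectation (p x) (\<lambda>v. exp (c * f x v)) \<le> \<dots>" .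
  qed
  also have "\<dots> = exp (?k * (\<Sum>x\<in>A. measure_pmf.expectation (p x) (f x)))"
    using \<open>finite A\<close> by (simp add: exp_sum sum_distrib_left)
  also have "(\<Sum>x\<in>A. measure_pmf.expectation (p x) (f x))
      = measure_pmf.expectation (Pi_pmf A d p) (\<lambda>y. \<Sum>x\<in>A. f x (y x))"
    using component integrable_component by (subst Bochner_Integration.integral_sum) auto
  finally show ?thesis .
qed

lemma nn_integral_replicate_pmf_exp:
  "(\<integral>\<^sup>+xs. ennreal (exp (sum_list (map f xs))) \<partial>replicate_pmf N p)
    = (\<integral>\<^sup>+x. ennreal (exp (f x)) \<partial>p) ^ N"
  by (induction N)
     (simp_all add: exp_add ennreal_mult nn_integral_cmult nn_integral_multc)

text \<open>Markov's inequality for the exponential of the sum, done with nonnegative integrals so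
  that integrability enters for a single sample only. The Chernoff parameter, with its sign, is
  absorbed into \<open>f\<close>.\<close>

lemma replicate_pmf_chernoff:
  fixes f :: "'a \<Rightarrow> real"
  assumes "integrable (measure_pmf p) (\<lambda>x. exp (f x))"
  shows "measure_pmf.prob (replicate_pmf N p) {xs. \<theta> \<le> sum_list (map f xs)}
    \<le> exp (- \<theta>) * measure_pmf.expectation p (\<lambda>x. exp (f x)) ^ N"
proof -
  let ?E = "measure_pmf.expectation p (\<lambda>x. exp (f x))"
  have "emeasure (replicate_pmf N p) {xs. \<theta> \<le> sum_list (map f xs)}
      = (\<integral>\<^sup>+xs. indicator {xs. \<theta> \<le> sum_list (map f xs)} xs \<partial>replicate_pmf N p)"
    by simp
  also have "\<dots> \<le> (\<integral>\<^sup>+xs. ennreal (exp (- \<theta>)) * ennreal (exp (sum_list (map f xs))) \<partial>replicate_pmf N p)"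
    by (intro nn_integral_mono) (auto simp: indicator_def simp flip: ennreal_mult exp_add ennreal_1)
  also have "\<dots> = ennreal (exp (- \<theta>)) * ennreal ?E ^ N"
    using assms
    by (simp add: nn_integral_cmult nn_integral_replicate_pmf_exp nn_integral_eq_integral)
  also have "\<dots> = ennreal (exp (- \<theta>) * ?E ^ N)"
    by (simp add: ennreal_mult ennreal_power)
  finally show ?thesis
    by (subst (asm) measure_pmf.emeasure_eq_measure) (simp add: ennreal_le_iff)
qed

section \<open>Softmin\<close>

text \<open>The norm expression with the negative exponent \<open>- \<beta>\<close>. On positive
  vectors it is concave, homogeneous of degree 1, at most the minimum, and at least the minimum
  divided by \<open>m powr (1 / \<beta>)\<close>.\<close>

definition softmin :: "real \<Rightarrow> nat \<Rightarrow> (nat \<Rightarrow> real) \<Rightarrow> real" where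
  "softmin \<beta> m v = (\<Sum>i<m. v i powr - \<beta>) powr (- 1 / \<beta>)"

text \<open>The closed form of the partial derivative of \<open>softmin\<close> in
  \<open>v i\<close>.\<close>

definition softmin_grad :: "real \<Rightarrow> nat \<Rightarrow> (nat \<Rightarrow> real) \<Rightarrow> nat \<Rightarrow> real" where
  "softmin_grad \<beta> m v i = (softmin \<beta> m v / v i) powr (\<beta> + 1)"

context
  fixes \<beta> :: real and m :: nat
  assumes \<beta>: "0 < \<beta>" and m: "0 < m"
begin

lemma softmin_sum_pos:
  assumes "\<And>i. i < m \<Longrightarrow> 0 < v i"
  shows "0 < (\<Sum>i<m. v i powr - \<beta>)"
  using m assms by (intro sum_pos) (auto simp: less_imp_neq[symmetric] intro: gr0I)

lemma softmin_pos:
  assumes "\<And>i. i < m \<Longrightarrow> 0 < v i"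
  shows "0 < softmin \<beta> m v"
  using softmin_sum_pos[of v] assms by (simp add: softmin_def)

lemma softmin_powr:
  assumes "\<And>i. i < m \<Longrightarrow> 0 < v i"
  shows "softmin \<beta> m v powr - \<beta> = (\<Sum>i<m. v i powr - \<beta>)"
  using softmin_sum_pos[of v] assms \<beta> by (simp add: softmin_def powr_powr)

lemma softmin_le:
  assumes "\<And>i. i < m \<Longrightarrow> 0 < v i" "i < m"
  shows "softmin \<beta> m v \<le> v i"
proof -
  have "v i powr - \<beta> \<le> (\<Sum>i<m. v i powr - \<beta>)"
    using assms by (intro member_le_sum) auto
  also have "\<dots> = softmin \<beta> m v powr - \<beta>"
    using softmin_powr assms by simp
  finally have "v i powr - \<beta> \<le> softmin \<beta> m v powr - \<beta>" .
  then show ?thesis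
    using softmin_pos[of v] assms \<beta> powr_less_mono2_neg[of "- \<beta>" "v i" "softmin \<beta> m v"]
    by (force simp: not_le[symmetric])
qed

lemma softmin_grad_nonneg: "0 \<le> softmin_grad \<beta> m v i"
  by (simp add: softmin_grad_def)

lemma softmin_grad_le_1:
  assumes "\<And>i. i < m \<Longrightarrow> 0 < v i" "i < m"
  shows "softmin_grad \<beta> m v i \<le> 1"
proof -
  have "0 < v i" "softmin \<beta> m v \<le> v i" "0 < softmin \<beta> m v"
    using softmin_le[of v i] softmin_pos[of v] assms by auto
  then show ?thesis
    unfolding softmin_grad_def using \<beta> by (intro powr_le1) auto
qed

text \<open>With \<open>r = u i / v i\<close> and \<open>x = v i powr - \<beta> / (\<Sum>i<m. v i powr - \<beta>)\<close> this says that the power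
  mean of \<open>r\<close> with weights \<open>x\<close> and exponent \<open>- \<beta>\<close> is at most the arithmetic mean.\<close>

lemma softmin_le_grad:
  assumes u: "\<And>i. i < m \<Longrightarrow> 0 < u i" and v: "\<And>i. i < m \<Longrightarrow> 0 < v i"
  shows "softmin \<beta> m u \<le> (\<Sum>i<m. softmin_grad \<beta> m v i * u i)"
proof -
  define s where "s = softmin \<beta> m v"
  have s: "0 < s" "s powr - \<beta> = (\<Sum>i<m. v i powr - \<beta>)"
    using softmin_pos[OF v] softmin_powr[OF v] by (auto simp: s_def)
  have s_norm: "s powr \<beta> * (\<Sum>i<m. v i powr - \<beta>) = 1"
    unfolding s(2)[symmetric] using s(1) by (simp add: powr_minus)
  define x where "x i = (s / v i) powr \<beta>" for i
  have x_pos: "0 < x i" if "i < m" for i using v[OF that] s by (simp add: x_def)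
  have x_eq: "x i = s powr \<beta> * v i powr - \<beta>" if "i < m" for i
    using v[OF that] s by (simp add: x_def powr_divide powr_minus_divide)
  have x_sum: "(\<Sum>i<m. x i) = 1"
    using s_norm x_eq by (simp flip: sum_distrib_left)
  define R where "R = (\<Sum>i<m. x i * (u i / v i))"
  have R: "0 < R"
    unfolding R_def using m u v x_pos by (intro sum_pos) (auto intro!: gr0I)
  \<comment> \<open>The tangent of r powr - \<beta> at r = \<open>R\<close>, obtained from ln q
    \<le> q - 1 and exp z \<ge> 1 + z. Summed with the weights \<open>x\<close>, the linear part
    vanishes, since the weights add up to 1 and \<open>R\<close> is the weighted mean.\<close>
  have term_ge: "x i * (u i / v i) powr - \<beta> \<ge> R powr - \<beta> * (x i + \<beta> * x i - \<beta> / R * (x i * (u i / v i)))"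
    if "i < m" for i
  proof -
    let ?q = "u i / v i / R"
    have q: "0 < ?q" using u v R that by simp
    have "1 - \<beta> * (?q - 1) \<le> 1 - \<beta> * ln ?q"
      using ln_le_minus_one[OF q] \<beta> by (simp add: mult_left_mono)
    also have "\<dots> \<le> ?q powr - \<beta>"
      using u[OF that] v[OF that] R exp_ge_add_one_self[of "- \<beta> * ln ?q"] by (simp add: powr_def)
    also have "?q powr - \<beta> = (u i / v i) powr - \<beta> / R powr - \<beta>"
      using u v R that by (simp add: powr_divide powr_mult)
    finally have "R powr - \<beta> * (1 - \<beta> * (?q - 1)) \<le> (u i / v i) powr - \<beta>"
      using R by (simp add: field_simps)
    then have "x i * (R powr - \<beta> * (1 - \<beta> * (?q - 1))) \<le> x i * (u i / v i) powr - \<beta>"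
      using x_pos[OF that] by (intro mult_left_mono) auto
    moreover have "x i * (R powr - \<beta> * (1 - \<beta> * (?q - 1)))
        = R powr - \<beta> * (x i + \<beta> * x i - \<beta> / R * (x i * (u i / v i)))"
      by (simp add: algebra_simps)
    ultimately show ?thesis by (simp only:)
  qed
  have "R powr - \<beta> = R powr - \<beta> * ((\<Sum>i<m. x i) + \<beta> * (\<Sum>i<m. x i) - \<beta> / R * R)"
    using R x_sum by simp
  also have "\<dots> = (\<Sum>i<m. R powr - \<beta> * (x i + \<beta> * x i - \<beta> / R * (x i * (u i / v i))))"
    by (simp only: sum_distrib_left[symmetric] sum.distrib sum_subtractf R_def[symmetric])
  also have "\<dots> \<le> (\<Sum>i<m. x i * (u i / v i) powr - \<beta>)"
    using term_ge by (intro sum_mono) auto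
  also have "\<dots> = s powr \<beta> * (\<Sum>i<m. u i powr - \<beta>)"
    unfolding sum_distrib_left
  proof (intro sum.cong refl)
    fix i assume "i \<in> {..<m}"
    then have "0 < u i" "0 < v i" using u v by auto
    then show "x i * (u i / v i) powr - \<beta> = s powr \<beta> * u i powr - \<beta>"
      using x_eq[of i] \<open>i \<in> {..<m}\<close> by (simp add: powr_divide powr_minus field_simps)
  qed
  also have "\<dots> = (softmin \<beta> m u / s) powr - \<beta>"
    using softmin_powr[of u, OF u, symmetric] softmin_pos[of u, OF u] s(1)
    by (simp add: powr_divide powr_minus field_simps del: sum_divide_distrib)
  finally have "softmin \<beta> m u / s \<le> R"
    using \<beta> R s softmin_pos[OF u] powr_less_mono2_neg[of "- \<beta>" R "softmin \<beta> m u / s"]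
    by (force simp: not_le[symmetric])
  then have "softmin \<beta> m u \<le> s * R"
    using s by (simp add: field_simps)
  also have "s * R = (\<Sum>i<m. softmin_grad \<beta> m v i * u i)"
    unfolding R_def sum_distrib_left
  proof (intro sum.cong refl)
    fix i assume "i \<in> {..<m}"
    then have "0 < v i" using v by auto
    then show "s * (x i * (u i / v i)) = softmin_grad \<beta> m v i * u i"
      using s by (simp add: softmin_grad_def x_def powr_add flip: s_def)
  qed
  finally show ?thesis .
qed

text \<open>Euler's identity for homogeneous functions of degree 1: the tangent inequality is tight
  at its base point.\<close>

lemma softmin_eq_grad:
  assumes v: "\<And>i. i < m \<Longrightarrow> 0 < v i"
  shows "softmin \<beta> m v = (\<Sum>i<m. softmin_grad \<beta> m v i * v i)"
proof -
  define s where "s = softmin \<beta> m v"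
  have s: "0 < s" "s powr - \<beta> = (\<Sum>i<m. v i powr - \<beta>)"
    using softmin_pos[OF v] softmin_powr[OF v] by (auto simp: s_def)
  have s_norm: "s powr \<beta> * (\<Sum>i<m. v i powr - \<beta>) = 1"
    unfolding s(2)[symmetric] using s(1) by (simp add: powr_minus)
  have "(\<Sum>i<m. softmin_grad \<beta> m v i * v i) = (\<Sum>i<m. s powr (\<beta> + 1) * v i powr - \<beta>)"
  proof (intro sum.cong refl)
    fix i assume "i \<in> {..<m}"
    then have "0 < v i" using v by auto
    then show "softmin_grad \<beta> m v i * v i = s powr (\<beta> + 1) * v i powr - \<beta>"
      using s(1) by (simp add: softmin_grad_def powr_divide powr_add powr_minus field_simps flip: s_def)
  qed
  also have "\<dots> = s"
    using s_norm s(1) by (simp add: powr_add flip: sum_distrib_left)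
  finally show ?thesis by (simp add: s_def)
qed

text \<open>Shares and gradient entries are both proportional to
  \<open>v i powr - (\<beta> + 1)\<close>. The shares sum to 1, and the gradient entries to at least
  \<open>m powr (- 1 / \<beta>)\<close> by the tangent inequality for the all-ones vector; the
  quotient of the two normalisations is the factor lost.\<close>

lemma powr_share_le_grad:
  assumes v: "\<And>i. i < m \<Longrightarrow> 0 < v i" and "k < m"
  shows "v k powr - (\<beta> + 1) / (\<Sum>i<m. v i powr - (\<beta> + 1)) \<le> real m powr (1 / \<beta>) * softmin_grad \<beta> m v k"
proof -
  define s where "s = softmin \<beta> m v"
  have s: "0 < s" using softmin_pos[OF v] by (simp add: s_def)
  let ?S = "\<Sum>i<m. v i powr - (\<beta> + 1)"
  have S: "0 < ?S" using m v by (intro sum_pos) (auto simp: less_imp_neq[symmetric])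
  have grad: "softmin_grad \<beta> m v i = s powr (\<beta> + 1) * v i powr - (\<beta> + 1)" if "i < m" for i
    unfolding powr_minus_divide using v[OF that] s
    by (simp add: softmin_grad_def powr_divide flip: s_def)
  have "real m powr (- 1 / \<beta>) = softmin \<beta> m (\<lambda>_. 1)"
    by (simp add: softmin_def)
  also have "\<dots> \<le> (\<Sum>i<m. softmin_grad \<beta> m v i)"
    using softmin_le_grad[of "\<lambda>_. 1" v] v by simp
  also have "\<dots> = s powr (\<beta> + 1) * ?S"
    using grad by (simp add: sum_distrib_left)
  finally have "real m powr (1 / \<beta>) * real m powr (- 1 / \<beta>) \<le> real m powr (1 / \<beta>) * (s powr (\<beta> + 1) * ?S)"
    by (intro mult_left_mono) auto
  then have "1 \<le> real m powr (1 / \<beta>) * s powr (\<beta> + 1) * ?S"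
    using m by (simp add: mult.assoc flip: powr_add)
  then have "v k powr - (\<beta> + 1) * 1 \<le> v k powr - (\<beta> + 1) * (real m powr (1 / \<beta>) * s powr (\<beta> + 1) * ?S)"
    by (intro mult_left_mono) auto
  then show ?thesis
    using S grad[OF \<open>k < m\<close>] by (simp add: field_simps)
qed

end

section \<open>Expected loads and dual multipliers\<close>

definition prop_load :: "nat \<Rightarrow> nat \<Rightarrow> real \<Rightarrow> (nat \<Rightarrow> real) \<Rightarrow> weights \<Rightarrow> nat \<Rightarrow> real" where
  "prop_load m n \<alpha> w P = load n P (prop_alloc m P \<alpha> w)"

definition mean_load :: "nat \<Rightarrow> nat \<Rightarrow> (nat \<Rightarrow> (nat \<Rightarrow> real) pmf) \<Rightarrow> real \<Rightarrow> (nat \<Rightarrow> real) \<Rightarrow> nat \<Rightarrow> real" where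
  "mean_load m n D \<alpha> w i = measure_pmf.expectation (instance_pmf n D) (\<lambda>P. prop_load m n \<alpha> w P i)"

lemma prop_alloc_nonneg:
  assumes "\<And>i. i < m \<Longrightarrow> 0 < w i" "i < m"
  shows "0 \<le> prop_alloc m P \<alpha> w i j"
  using assms by (auto simp: prop_alloc_def less_imp_le intro!: divide_nonneg_nonneg sum_nonneg mult_nonneg_nonneg)

lemma prop_alloc_le_1:
  assumes "\<And>i. i < m \<Longrightarrow> 0 < w i" "i < m"
  shows "prop_alloc m P \<alpha> w i j \<le> 1"
proof -
  have "P i j powr \<alpha> * w i \<le> (\<Sum>i'<m. P i' j powr \<alpha> * w i')"
    using assms by (intro member_le_sum) (auto simp: less_imp_le)
  moreover have "0 \<le> P i j powr \<alpha> * w i"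
    using assms by (simp add: less_imp_le)
  ultimately show ?thesis
    by (simp add: prop_alloc_def divide_le_eq)
qed

text \<open>\<open>A\<close> bounds the growth of the numerator and \<open>B\<close> the shrinking
  of the normalising sum.\<close>

lemma prop_alloc_perturb:
  assumes P: "\<And>i. i < m \<Longrightarrow> 0 < P i j" and w: "\<And>i. i < m \<Longrightarrow> 0 < w i" and w': "\<And>i. i < m \<Longrightarrow> 0 < w' i"
    and A: "\<And>i. i < m \<Longrightarrow> w i \<le> A * w' i" and B: "\<And>i. i < m \<Longrightarrow> w' i \<le> B * w i"
    and "k < m"
  shows "prop_alloc m P \<alpha> w k j \<le> A * B * prop_alloc m P \<alpha> w' k j"
proof -
  define S where "S v = (\<Sum>i<m. P i j powr \<alpha> * v i)" for v
  have S: "0 < S v" if "\<And>i. i < m \<Longrightarrow> 0 < v i" for v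
    unfolding S_def using that P \<open>k < m\<close>
    by (intro sum_pos) (force simp: less_imp_neq[symmetric])+
  have "S w' \<le> (\<Sum>i<m. B * (P i j powr \<alpha> * w i))"
    unfolding S_def using mult_left_mono[OF B, of _ "P _ j powr \<alpha>"]
    by (intro sum_mono) (auto simp: mult_ac)
  also have "\<dots> = B * S w" by (simp add: S_def sum_distrib_left)
  finally have SB: "S w' \<le> B * S w" .
  have "P k j powr \<alpha> * w k * S w' \<le> (P k j powr \<alpha> * (A * w' k)) * (B * S w)"
    using SB A[OF \<open>k < m\<close>] S[of w, OF w] S[of w', OF w'] w[OF \<open>k < m\<close>]
    by (intro mult_mono) (auto intro!: mult_nonneg_nonneg intro: order_trans[of 0 "w k"])
  then have "P k j powr \<alpha> * w k / S w \<le> A * B * (P k j powr \<alpha> * w' k / S w')"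
    using S[of w, OF w] S[of w', OF w'] by (simp add: field_simps)
  then show ?thesis
    by (simp add: prop_alloc_def S_def)
qed

lemma feasible_uniform: "0 < m \<Longrightarrow> (\<lambda>_ _. 1 / real m) \<in> feasible m n"
  by (simp add: feasible_def)

lemma max_load_ge: "i < m \<Longrightarrow> load n P X i \<le> max_load m n P X"
  by (simp add: max_load_def)

text \<open>This serves the integrability of the optimum; the upper bound is witnessed by the
  uniform allocation.\<close>

lemma opt_mks_bounds:
  assumes P: "\<And>i j. i < m \<Longrightarrow> j < n \<Longrightarrow> 0 \<le> P i j \<and> P i j \<le> b" and "0 < m"
  shows "0 \<le> opt_mks m n P \<and> opt_mks m n P \<le> real n * b"
proof
  have nonneg: "0 \<le> max_load m n P X" if "X \<in> feasible m n" for X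
  proof -
    have "0 \<le> load n P X 0"
      using that P \<open>0 < m\<close> by (auto simp: load_def feasible_def intro!: sum_nonneg mult_nonneg_nonneg)
    with max_load_ge[OF \<open>0 < m\<close>] show ?thesis by (rule order_trans[rotated])
  qed
  then show "0 \<le> opt_mks m n P"
    unfolding opt_mks_def using feasible_uniform[OF \<open>0 < m\<close>] by (intro cINF_greatest) auto
  have "opt_mks m n P \<le> max_load m n P (\<lambda>_ _. 1 / real m)"
    unfolding opt_mks_def using feasible_uniform[OF \<open>0 < m\<close>] nonneg
    by (intro cINF_lower bdd_belowI2[where m = 0]) auto
  also have "\<dots> \<le> real n * b"
    unfolding max_load_def
  proof (rule Max.boundedI)
    fix l assume "l \<in> load n P (\<lambda>_ _. 1 / real m) ` {..<m}"
    then obtain i where "i < m" and l: "l = (\<Sum>j<n. P i j * (1 / real m))"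
      by (auto simp: load_def)
    then have "l \<le> (\<Sum>j<n. b * 1)"
      unfolding l using P \<open>0 < m\<close> 
      by (intro sum_mono mult_mono) (force intro: order_trans)+
    then show "l \<le> real n * b" by simp
  qed (use \<open>0 < m\<close> in auto)
  finally show "opt_mks m n P \<le> real n * b" .
qed

text \<open>Weak duality: the \<open>y i\<close> are the dual multipliers of the load constraints.\<close>

lemma sum_softmin_le_opt_mks:
  assumes "0 < \<beta>" "0 < m"
    and P: "\<And>i j. i < m \<Longrightarrow> j < n \<Longrightarrow> 0 < P i j"
    and y: "\<And>i. i < m \<Longrightarrow> 0 < y i" "(\<Sum>i<m. y i) = 1"
  shows "(\<Sum>j<n. softmin \<beta> m (\<lambda>i. y i * P i j)) \<le> opt_mks m n P"
  unfolding opt_mks_def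
proof (rule cINF_greatest)
  show "feasible m n \<noteq> {}" using feasible_uniform[OF \<open>0 < m\<close>] by blast
  fix X assume X: "X \<in> feasible m n"
  have "(\<Sum>j<n. softmin \<beta> m (\<lambda>i. y i * P i j)) \<le> (\<Sum>j<n. \<Sum>i<m. X i j * (y i * P i j))"
  proof (rule sum_mono)
    fix j assume "j \<in> {..<n}"
    then have "softmin \<beta> m (\<lambda>i. y i * P i j) = (\<Sum>i<m. X i j * softmin \<beta> m (\<lambda>i. y i * P i j))"
      using X by (simp add: feasible_def flip: sum_distrib_right)
    also have "\<dots> \<le> (\<Sum>i<m. X i j * (y i * P i j))"
      using X \<open>j \<in> {..<n}\<close> y P assms(1,2)
      by (intro sum_mono mult_left_mono softmin_le) (auto simp: feasible_def)
    finally show "softmin \<beta> m (\<lambda>i. y i * P i j) \<le> \<dots>" .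
  qed
  also have "\<dots> = (\<Sum>i<m. y i * load n P X i)"
    by (subst sum.swap) (simp add: load_def sum_distrib_left mult_ac)
  also have "\<dots> \<le> (\<Sum>i<m. y i * max_load m n P X)"
    using y max_load_ge by (intro sum_mono mult_left_mono) (auto simp: less_imp_le)
  also have "\<dots> = max_load m n P X"
    using y by (simp flip: sum_distrib_right)
  finally show "(\<Sum>j<n. softmin \<beta> m (\<lambda>i. y i * P i j)) \<le> max_load m n P X" .
qed

section \<open>Loads of random instances with bounded entries\<close>

text \<open>The bound \<open>b\<close> stands for the T / \<zeta> of the small items assumption.
  Lemmas that need the relation between \<open>b\<close> and the expected optimum state it as a
  hypothesis.\<close>

locale bounded_columns =
  fixes m n :: nat and D :: "nat \<Rightarrow> (nat \<Rightarrow> real) pmf" and b :: real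
  assumes m_pos: "0 < m" and b_pos: "0 < b"
    and columns: "D \<in> column_dists m n"
    and entry_le: "\<And>P i j. P \<in> set_pmf (instance_pmf n D) \<Longrightarrow> i < m \<Longrightarrow> j < n \<Longrightarrow> P i j \<le> b"
begin

text \<open>Every column in the support of \<open>D j\<close> occurs in some supported instance, so
  the bound on instances passes to single columns, where the product estimate needs it.\<close>

lemma column_bounds:
  assumes "j < n" "v \<in> set_pmf (D j)" "i < m"
  shows "0 < v i \<and> v i \<le> b"
proof
  show "0 < v i"
    using assms columns by (auto simp: column_dists_def pos_vecs_def)
  have "D j = map_pmf (\<lambda>c. c j) (Pi_pmf {..<n} (\<lambda>_. undefined) D)"
    using Pi_pmf_component[of "{..<n}" j "\<lambda>_. undefined" D] assms by simp
  with assms(2) obtain c where "c \<in> set_pmf (Pi_pmf {..<n} (\<lambda>_. undefined) D)" "v = c j"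
    by (metis (no_types, lifting) image_iff set_map_pmf)
  then show "v i \<le> b"
    using entry_le[of "\<lambda>i j. c j i" i j] assms by (auto simp: instance_pmf_def)
qed

lemma entry_bounds:
  assumes "P \<in> set_pmf (instance_pmf n D)" "i < m" "j < n"
  shows "0 < P i j \<and> P i j \<le> b"
proof -
  obtain c where "c \<in> set_pmf (Pi_pmf {..<n} (\<lambda>_. undefined) D)" "P = (\<lambda>i j. c j i)"
    using assms(1) by (auto simp: instance_pmf_def)
  then show ?thesis
    using column_bounds[of j "c j" i] assms by (auto simp: set_Pi_pmf PiE_dflt_def)
qed

lemma prop_load_bounds:
  assumes "P \<in> set_pmf (instance_pmf n D)" "\<And>i. i < m \<Longrightarrow> 0 < w i" "i < m"
  shows "0 \<le> prop_load m n \<alpha> w P i \<and> prop_load m n \<alpha> w P i \<le> real n * b"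
proof -
  have "prop_load m n \<alpha> w P i \<le> (\<Sum>j<n. b * 1)"
    unfolding prop_load_def load_def
    using entry_bounds[OF assms(1) assms(3)] b_pos
      prop_alloc_nonneg[of m w i P \<alpha>, OF assms(2,3)] prop_alloc_le_1[of m w i P \<alpha>, OF assms(2,3)]
    by (intro sum_mono mult_mono) auto
  moreover have "0 \<le> prop_load m n \<alpha> w P i"
    unfolding prop_load_def load_def
    using entry_bounds[OF assms(1) assms(3)] prop_alloc_nonneg[of m w i P \<alpha>, OF assms(2,3)]
    by (intro sum_nonneg mult_nonneg_nonneg) (auto simp: less_imp_le)
  ultimately show ?thesis by simp
qed

lemma integrable_prop_load:
  assumes "\<And>i. i < m \<Longrightarrow> 0 < w i" "i < m"
  shows "integrable (measure_pmf (instance_pmf n D)) (\<lambda>P. prop_load m n \<alpha> w P i)"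
  using prop_load_bounds[where w = w, OF _ assms] by (intro integrable_pmf_bounded[where B = "real n * b"]) auto

lemma integrable_exp_prop_load:
  assumes "\<And>i. i < m \<Longrightarrow> 0 < w i" "i < m"
  shows "integrable (measure_pmf (instance_pmf n D)) (\<lambda>P. exp (c * prop_load m n \<alpha> w P i))"
proof (rule integrable_pmf_bounded[where B = "exp (\<bar>c\<bar> * (real n * b))"])
  fix P assume "P \<in> set_pmf (instance_pmf n D)"
  with prop_load_bounds[where w = w, OF _ assms] have "0 \<le> prop_load m n \<alpha> w P i" "prop_load m n \<alpha> w P i \<le> real n * b"
    by auto
  then have "c * prop_load m n \<alpha> w P i \<le> \<bar>c\<bar> * (real n * b)"
    by (intro mult_mono) auto
  then show "\<bar>exp (c * prop_load m n \<alpha> w P i)\<bar> \<le> exp (\<bar>c\<bar> * (real n * b))" by simp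
qed

text \<open>The proportional allocation of an item depends on its own column only, so a load is a
  sum of independent terms in [0, b]. To express this, \<open>f\<close> evaluates the allocation on
  the matrix all of whose columns equal \<open>v\<close>.\<close>

lemma mgf_prop_load_le:
  assumes w: "\<And>i. i < m \<Longrightarrow> 0 < w i" and "i < m"
  shows "measure_pmf.expectation (instance_pmf n D) (\<lambda>P. exp (c * prop_load m n \<alpha> w P i))
    \<le> exp ((exp (c * b) - 1) / b * mean_load m n D \<alpha> w i)"
proof -
  define f where "f j v = v i * prop_alloc m (\<lambda>i _. v i) \<alpha> w i j" for j :: nat and v :: "nat \<Rightarrow> real"
  have f: "prop_load m n \<alpha> w (\<lambda>i j. c j i) i = (\<Sum>j<n. f j (c j))" for c
    by (simp add: prop_load_def load_def f_def prop_alloc_def)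
  have "0 \<le> f j v \<and> f j v \<le> b" if "j \<in> {..<n}" "v \<in> set_pmf (D j)" for j v
  proof -
    have v: "0 < v i" "v i \<le> b" using column_bounds that \<open>i < m\<close> by auto
    then have "f j v \<le> b * 1"
      unfolding f_def using b_pos w \<open>i < m\<close>
      by (intro mult_mono prop_alloc_le_1 prop_alloc_nonneg) auto
    moreover have "0 \<le> f j v"
      unfolding f_def using v w \<open>i < m\<close> by (intro mult_nonneg_nonneg prop_alloc_nonneg) auto
    ultimately show ?thesis by simp
  qed
  from mgf_Pi_pmf_le[OF finite_lessThan b_pos this, where c = c and d = "\<lambda>_. undefined"]
  show ?thesis
    by (simp add: mean_load_def instance_pmf_def f)
qed

lemma mean_load_nonneg:
  assumes "\<And>i. i < m \<Longrightarrow> 0 < w i" "i < m"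
  shows "0 \<le> mean_load m n D \<alpha> w i"
  unfolding mean_load_def using prop_load_bounds[where w = w, OF _ assms]
  by (intro integral_nonneg_AE) (auto simp: AE_measure_pmf_iff)

lemma mean_load_perturb:
  assumes w: "\<And>i. i < m \<Longrightarrow> 0 < w i" and w': "\<And>i. i < m \<Longrightarrow> 0 < w' i"
    and "\<And>i. i < m \<Longrightarrow> w i \<le> A * w' i" "\<And>i. i < m \<Longrightarrow> w' i \<le> B * w i" "k < m"
  shows "mean_load m n D \<alpha> w k \<le> A * B * mean_load m n D \<alpha> w' k"
proof -
  have "mean_load m n D \<alpha> w k \<le> measure_pmf.expectation (instance_pmf n D) (\<lambda>P. A * B * prop_load m n \<alpha> w' P k)"
    unfolding mean_load_def
  proof (rule expectation_pmf_mono)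
    fix P assume P: "P \<in> set_pmf (instance_pmf n D)"
    show "prop_load m n \<alpha> w P k \<le> A * B * prop_load m n \<alpha> w' P k"
      unfolding prop_load_def load_def sum_distrib_left
    proof (rule sum_mono)
      fix j assume "j \<in> {..<n}"
      then have "P k j * prop_alloc m P \<alpha> w k j \<le> P k j * (A * B * prop_alloc m P \<alpha> w' k j)"
        using entry_bounds[OF P] assms
        by (intro mult_left_mono prop_alloc_perturb) (auto simp: less_imp_le)
      then show "P k j * prop_alloc m P \<alpha> w k j \<le> A * B * (P k j * prop_alloc m P \<alpha> w' k j)"
        by (simp add: mult_ac)
    qed
  qed (use integrable_prop_load[where w = w, OF w] integrable_prop_load[where w = w', OF w'] \<open>k < m\<close> in auto)
  then show ?thesis by (simp add: mean_load_def)
qed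

lemma integrable_opt_mks: "integrable (measure_pmf (instance_pmf n D)) (opt_mks m n)"
proof (rule integrable_pmf_bounded[where B = "real n * b"])
  fix P assume "P \<in> set_pmf (instance_pmf n D)"
  then show "\<bar>opt_mks m n P\<bar> \<le> real n * b"
    using opt_mks_bounds[of m n P b] entry_bounds[of P] m_pos by (auto simp: less_imp_le)
qed

section \<open>The dual potential and its gradient\<close>

definition potential :: "real \<Rightarrow> (nat \<Rightarrow> real) \<Rightarrow> real" where
  "potential \<beta> y = measure_pmf.expectation (instance_pmf n D) (\<lambda>P. \<Sum>j<n. softmin \<beta> m (\<lambda>i. y i * P i j))"

text \<open>The partial derivative of \<open>potential\<close> in \<open>y k\<close>, taken under
  the expectation.\<close>

definition potential_grad :: "real \<Rightarrow> (nat \<Rightarrow> real) \<Rightarrow> nat \<Rightarrow> real" where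
  "potential_grad \<beta> y k = measure_pmf.expectation (instance_pmf n D)
     (\<lambda>P. \<Sum>j<n. P k j * softmin_grad \<beta> m (\<lambda>i. y i * P i j) k)"

context
  fixes \<beta> :: real
  assumes \<beta>: "0 < \<beta>"
begin

lemma potential_summand_bounds:
  assumes "P \<in> set_pmf (instance_pmf n D)" "\<And>i. i < m \<Longrightarrow> 0 < y i"
  shows "0 \<le> (\<Sum>j<n. softmin \<beta> m (\<lambda>i. y i * P i j))"
    and "(\<Sum>j<n. softmin \<beta> m (\<lambda>i. y i * P i j)) \<le> real n * (y 0 * b)"
proof -
  have pos: "0 < y i * P i j" if "i < m" "j < n" for i j
    using entry_bounds[OF assms(1)] assms(2) that by simp
  show "0 \<le> (\<Sum>j<n. softmin \<beta> m (\<lambda>i. y i * P i j))"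
    using pos by (intro sum_nonneg less_imp_le[OF softmin_pos] \<beta> m_pos) auto
  have "(\<Sum>j<n. softmin \<beta> m (\<lambda>i. y i * P i j)) \<le> (\<Sum>j<n. y 0 * b)"
  proof (rule sum_mono)
    fix j assume "j \<in> {..<n}"
    then have "softmin \<beta> m (\<lambda>i. y i * P i j) \<le> y 0 * P 0 j"
      using pos m_pos by (intro softmin_le \<beta>) auto
    also have "\<dots> \<le> y 0 * b"
      using entry_bounds[OF assms(1), of 0 j] assms(2)[of 0] m_pos \<open>j \<in> {..<n}\<close>
      by (intro mult_left_mono) auto
    finally show "softmin \<beta> m (\<lambda>i. y i * P i j) \<le> y 0 * b" .
  qed
  then show "(\<Sum>j<n. softmin \<beta> m (\<lambda>i. y i * P i j)) \<le> real n * (y 0 * b)" by simp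
qed

lemma integrable_potential:
  assumes "\<And>i. i < m \<Longrightarrow> 0 < y i"
  shows "integrable (measure_pmf (instance_pmf n D)) (\<lambda>P. \<Sum>j<n. softmin \<beta> m (\<lambda>i. y i * P i j))"
  using potential_summand_bounds[where y = y, OF _ assms]
  by (intro integrable_pmf_bounded[where B = "real n * (y 0 * b)"]) auto

lemma potential_grad_summand_bounds:
  assumes "P \<in> set_pmf (instance_pmf n D)" "\<And>i. i < m \<Longrightarrow> 0 < y i" "k < m"
  shows "0 \<le> (\<Sum>j<n. P k j * softmin_grad \<beta> m (\<lambda>i. y i * P i j) k)"
    and "(\<Sum>j<n. P k j * softmin_grad \<beta> m (\<lambda>i. y i * P i j) k) \<le> real n * b"
proof -
  have P: "0 < P i j" "P i j \<le> b" if "i < m" "j < n" for i j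
    using entry_bounds[OF assms(1)] that by auto
  show "0 \<le> (\<Sum>j<n. P k j * softmin_grad \<beta> m (\<lambda>i. y i * P i j) k)"
    using P \<open>k < m\<close> by (intro sum_nonneg mult_nonneg_nonneg softmin_grad_nonneg \<beta> m_pos) (auto simp: less_imp_le)
  have "(\<Sum>j<n. P k j * softmin_grad \<beta> m (\<lambda>i. y i * P i j) k) \<le> (\<Sum>j<n. b * 1)"
    using P assms b_pos
    by (intro sum_mono mult_mono softmin_grad_le_1 softmin_grad_nonneg \<beta> m_pos) auto
  then show "(\<Sum>j<n. P k j * softmin_grad \<beta> m (\<lambda>i. y i * P i j) k) \<le> real n * b" by simp
qed

lemma integrable_potential_grad:
  assumes "\<And>i. i < m \<Longrightarrow> 0 < y i" "k < m"
  shows "integrable (measure_pmf (instance_pmf n D)) (\<lambda>P. \<Sum>j<n. P k j * softmin_grad \<beta> m (\<lambda>i. y i * P i j) k)"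
  using potential_grad_summand_bounds[where y = y, OF _ assms]
  by (intro integrable_pmf_bounded[where B = "real n * b"]) auto

lemma potential_grad_nonneg:
  assumes "\<And>i. i < m \<Longrightarrow> 0 < y i" "k < m"
  shows "0 \<le> potential_grad \<beta> y k"
  unfolding potential_grad_def using potential_grad_summand_bounds[where y = y, OF _ assms]
  by (intro integral_nonneg_AE) (auto simp: AE_measure_pmf_iff)

lemma potential_le_expected_opt:
  assumes "\<And>i. i < m \<Longrightarrow> 0 < y i" "(\<Sum>i<m. y i) = 1"
  shows "potential \<beta> y \<le> expected_opt m n D"
  unfolding potential_def expected_opt_def
  using assms entry_bounds
  by (intro expectation_pmf_mono integrable_potential integrable_opt_mks sum_softmin_le_opt_mks \<beta> m_pos) auto

lemma sum_potential_grad: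
  assumes "\<And>i. i < m \<Longrightarrow> 0 < y i"
  shows "(\<Sum>i<m. u i * potential_grad \<beta> y i) = measure_pmf.expectation (instance_pmf n D)
    (\<lambda>P. \<Sum>j<n. \<Sum>i<m. softmin_grad \<beta> m (\<lambda>i. y i * P i j) i * (u i * P i j))"
proof -
  have "(\<Sum>i<m. u i * potential_grad \<beta> y i) = measure_pmf.expectation (instance_pmf n D)
    (\<lambda>P. \<Sum>i<m. u i * (\<Sum>j<n. P i j * softmin_grad \<beta> m (\<lambda>i. y i * P i j) i))"
    unfolding potential_grad_def using integrable_potential_grad[where y = y, OF assms]
    by (subst Bochner_Integration.integral_sum) auto
  also have "(\<lambda>P. \<Sum>i<m. u i * (\<Sum>j<n. P i j * softmin_grad \<beta> m (\<lambda>i. y i * P i j) i))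
    = (\<lambda>P. \<Sum>j<n. \<Sum>i<m. softmin_grad \<beta> m (\<lambda>i. y i * P i j) i * (u i * P i j))"
    by (subst sum.swap) (simp add: sum_distrib_left mult_ac)
  finally show ?thesis .
qed

lemma integrable_sum_potential_grad:
  assumes "\<And>i. i < m \<Longrightarrow> 0 < y i"
  shows "integrable (measure_pmf (instance_pmf n D))
    (\<lambda>P. \<Sum>j<n. \<Sum>i<m. softmin_grad \<beta> m (\<lambda>i. y i * P i j) i * (u i * P i j))"
proof -
  have "(\<lambda>P. \<Sum>j<n. \<Sum>i<m. softmin_grad \<beta> m (\<lambda>i. y i * P i j) i * (u i * P i j))
    = (\<lambda>P. \<Sum>i<m. u i * (\<Sum>j<n. P i j * softmin_grad \<beta> m (\<lambda>i. y i * P i j) i))"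
    by (subst sum.swap) (simp add: sum_distrib_left mult_ac)
  then show ?thesis
    using integrable_potential_grad[where y = y, OF assms] by auto
qed

text \<open>The tangent inequality of the concave homogeneous softmin, summed over the items and
  averaged over instances; \<open>potential_eq_grad\<close> is the corresponding Euler
  identity.\<close>

lemma potential_le_grad:
  assumes u: "\<And>i. i < m \<Longrightarrow> 0 < u i" and y: "\<And>i. i < m \<Longrightarrow> 0 < y i"
  shows "potential \<beta> u \<le> (\<Sum>i<m. u i * potential_grad \<beta> y i)"
proof -
  have "(\<Sum>i<m. u i * potential_grad \<beta> y i) = measure_pmf.expectation (instance_pmf n D)
    (\<lambda>P. \<Sum>j<n. \<Sum>i<m. softmin_grad \<beta> m (\<lambda>i. y i * P i j) i * (u i * P i j))"
    by (intro sum_potential_grad y)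
  moreover have "potential \<beta> u \<le> \<dots>"
    unfolding potential_def using entry_bounds u y
    by (intro expectation_pmf_mono integrable_potential integrable_sum_potential_grad sum_mono
        softmin_le_grad \<beta> m_pos) auto
  ultimately show ?thesis by simp
qed

lemma potential_eq_grad:
  assumes y: "\<And>i. i < m \<Longrightarrow> 0 < y i"
  shows "potential \<beta> y = (\<Sum>i<m. y i * potential_grad \<beta> y i)"
proof -
  have "(\<Sum>i<m. y i * potential_grad \<beta> y i) = measure_pmf.expectation (instance_pmf n D)
    (\<lambda>P. \<Sum>j<n. \<Sum>i<m. softmin_grad \<beta> m (\<lambda>i. y i * P i j) i * (y i * P i j))"
    by (intro sum_potential_grad y)
  moreover have "potential \<beta> y = \<dots>"
    unfolding potential_def using entry_bounds y
    by (intro integral_cong_AE) (auto simp: AE_measure_pmf_iff intro!: sum.cong softmin_eq_grad \<beta> m_pos)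
  ultimately show ?thesis by simp
qed

text \<open>This is the reason for the exponent \<open>- (\<beta> + 1)\<close>: with these weights
  the share of agent \<open>k\<close> in item \<open>j\<close> is proportional to
  \<open>(y k * P k j) powr - (\<beta> + 1)\<close>, which is the direction of the softmin gradient
  at the vector of the \<open>y i * P i j\<close>.\<close>

lemma mean_load_le_grad:
  assumes y: "\<And>i. i < m \<Longrightarrow> 0 < y i" and "k < m"
  shows "mean_load m n D (- (\<beta> + 1)) (\<lambda>i. y i powr - (\<beta> + 1)) k
    \<le> real m powr (1 / \<beta>) * potential_grad \<beta> y k"
proof -
  have "mean_load m n D (- (\<beta> + 1)) (\<lambda>i. y i powr - (\<beta> + 1)) k \<le> measure_pmf.expectation (instance_pmf n D)
     (\<lambda>P. real m powr (1 / \<beta>) * (\<Sum>j<n. P k j * softmin_grad \<beta> m (\<lambda>i. y i * P i j) k))"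
    unfolding mean_load_def
  proof (rule expectation_pmf_mono)
    fix P assume P: "P \<in> set_pmf (instance_pmf n D)"
    show "prop_load m n (- (\<beta> + 1)) (\<lambda>i. y i powr - (\<beta> + 1)) P k
      \<le> real m powr (1 / \<beta>) * (\<Sum>j<n. P k j * softmin_grad \<beta> m (\<lambda>i. y i * P i j) k)"
      unfolding prop_load_def load_def sum_distrib_left
    proof (rule sum_mono)
      fix j assume j: "j \<in> {..<n}"
      have eq: "P i j powr - (\<beta> + 1) * y i powr - (\<beta> + 1) = (y i * P i j) powr - (\<beta> + 1)" if "i < m" for i
        using entry_bounds[OF P that] y[OF that] j by (subst powr_mult) auto
      have "prop_alloc m P (- (\<beta> + 1)) (\<lambda>i. y i powr - (\<beta> + 1)) k j
        = (y k * P k j) powr - (\<beta> + 1) / (\<Sum>i<m. (y i * P i j) powr - (\<beta> + 1))"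
        unfolding prop_alloc_def using eq \<open>k < m\<close> by (intro arg_cong2[where f = divide] sum.cong) auto
      also have "\<dots> \<le> real m powr (1 / \<beta>) * softmin_grad \<beta> m (\<lambda>i. y i * P i j) k"
        using powr_share_le_grad[OF \<beta> m_pos, of "\<lambda>i. y i * P i j" k] entry_bounds[OF P] y j \<open>k < m\<close> by auto
      finally have "P k j * prop_alloc m P (- (\<beta> + 1)) (\<lambda>i. y i powr - (\<beta> + 1)) k j
        \<le> P k j * (real m powr (1 / \<beta>) * softmin_grad \<beta> m (\<lambda>i. y i * P i j) k)"
        using entry_bounds[OF P] j \<open>k < m\<close> by (intro mult_left_mono) (auto simp: less_imp_le)
      then show "P k j * prop_alloc m P (- (\<beta> + 1)) (\<lambda>i. y i powr - (\<beta> + 1)) k j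
        \<le> real m powr (1 / \<beta>) * (P k j * softmin_grad \<beta> m (\<lambda>i. y i * P i j) k)"
        by (simp add: mult_ac)
    qed
  next
    have "0 < y i powr - (\<beta> + 1)" if "i < m" for i using y[OF that] by simp
    then show "integrable (measure_pmf (instance_pmf n D))
        (\<lambda>P. prop_load m n (- (\<beta> + 1)) (\<lambda>i. y i powr - (\<beta> + 1)) P k)"
      using \<open>k < m\<close> by (intro integrable_prop_load) auto
    show "integrable (measure_pmf (instance_pmf n D))
        (\<lambda>P. real m powr (1 / \<beta>) * (\<Sum>j<n. P k j * softmin_grad \<beta> m (\<lambda>i. y i * P i j) k))"
      using integrable_potential_grad[where y = y, OF y \<open>k < m\<close>] by simp
  qed
  then show ?thesis by (simp add: potential_grad_def)
qed

text \<open>At an approximate maximiser \<open>y\<close> of the concave potential on the truncated simplex, moving a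
  small step \<open>t\<close> towards the vertex of agent \<open>k\<close> shows that the \<open>k\<close>th partial derivative at the
  new point is not much larger than the potential. The gap \<open>t * \<tau>\<close> makes a true maximiser
  unnecessary, and \<open>t / \<delta>\<close> bounds the relative change of \<open>y\<close>.\<close>

lemma ex_multipliers:
  assumes t: "0 < t" "t < 1" and "0 < \<tau>" and \<delta>: "0 < \<delta>" "real m * \<delta> < 1"
  shows "\<exists>y. (\<forall>i<m. \<delta> \<le> y i \<and> y i \<le> 1) \<and> (\<forall>k<m. mean_load m n D (- (\<beta> + 1)) (\<lambda>i. y i powr - (\<beta> + 1)) k
    \<le> ((1 + t / \<delta>) / (1 - t)) powr (\<beta> + 1) * (real m powr (1 / \<beta>) *
      ((expected_opt m n D / (1 - t) + \<tau>) / (1 - real m * \<delta>))))"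
proof -
  let ?T = "expected_opt m n D"
  define \<Delta> where "\<Delta> = {y. (\<forall>i<m. \<delta> \<le> y i) \<and> (\<Sum>i<m. y i) = 1}"
  have \<Delta>_pos: "0 < y i" if "y \<in> \<Delta>" "i < m" for y i
    using that \<delta> by (force simp: \<Delta>_def)
  have \<Delta>_le: "y i \<le> 1" if "y \<in> \<Delta>" "i < m" for y i
  proof -
    have "y i \<le> (\<Sum>i<m. y i)"
      using that \<Delta>_pos by (intro member_le_sum) (auto simp: less_imp_le)
    with that show ?thesis by (simp add: \<Delta>_def)
  qed
  have "(\<lambda>_. 1 / real m) \<in> \<Delta>"
    using \<delta> m_pos by (auto simp: \<Delta>_def field_simps)
  then have ne: "\<Delta> \<noteq> {}" by blast
  have bdd: "bdd_above (potential \<beta> ` \<Delta>)"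
    using potential_le_expected_opt \<Delta>_pos by (intro bdd_aboveI2[where M = ?T]) (auto simp: \<Delta>_def)
  have "(SUP y\<in>\<Delta>. potential \<beta> y) - t * \<tau> < (SUP y\<in>\<Delta>. potential \<beta> y)"
    using t \<open>0 < \<tau>\<close> by simp
  then obtain y where y: "y \<in> \<Delta>" "(SUP y\<in>\<Delta>. potential \<beta> y) - t * \<tau> < potential \<beta> y"
    unfolding less_cSUP_iff[OF ne bdd] by blast
  have y_max: "potential \<beta> y' \<le> potential \<beta> y + t * \<tau>" if "y' \<in> \<Delta>" for y'
    using cSUP_upper[OF that bdd] y(2) by simp
  have "mean_load m n D (- (\<beta> + 1)) (\<lambda>i. y i powr - (\<beta> + 1)) k
    \<le> ((1 + t / \<delta>) / (1 - t)) powr (\<beta> + 1) * (real m powr (1 / \<beta>) * ((?T / (1 - t) + \<tau>) / (1 - real m * \<delta>)))"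
    if "k < m" for k
  proof -
    \<comment> \<open>The vertex of the truncated simplex belonging to \<open>k\<close>: all mass
      above the floor \<open>\<delta>\<close> goes to agent \<open>k\<close>.\<close>
    define z where "z i = \<delta> + (if i = k then 1 - real m * \<delta> else 0)" for i
    define y' where "y' i = (1 - t) * y i + t * z i" for i
    define g where "g = potential_grad \<beta> y'"
    have z: "z \<in> \<Delta>"
      using \<delta> \<open>k < m\<close> by (auto simp: \<Delta>_def z_def sum.distrib)
    have "\<delta> \<le> y' i" if "i < m" for i
    proof -
      have "(1 - t) * \<delta> + t * \<delta> \<le> y' i"
        unfolding y'_def using y z that t by (intro add_mono mult_left_mono) (auto simp: \<Delta>_def)
      then show ?thesis by (simp add: algebra_simps)
    qed
    moreover have "(\<Sum>i<m. y' i) = 1"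
      using y z by (simp add: y'_def sum.distrib \<Delta>_def flip: sum_distrib_left)
    ultimately have y': "y' \<in> \<Delta>" by (simp add: \<Delta>_def)
    note pos = \<Delta>_pos[OF y(1)] \<Delta>_pos[OF y'] \<Delta>_pos[OF z]
    have g_nonneg: "0 \<le> g i" if "i < m" for i
      unfolding g_def using pos that by (intro potential_grad_nonneg) auto
    define Gy Gz where "Gy = (\<Sum>i<m. y i * g i)" and "Gz = (\<Sum>i<m. z i * g i)"
    \<comment> \<open>Euler's identity at \<open>y'\<close>, split along the convex combination.
      With the tangent inequality at \<open>y'\<close> and the near-maximality of \<open>y\<close>
      it gives (1 - t) Gy + t Gz \<le> Gy + t \<tau>, hence Gz \<le> Gy + \<tau>.\<close>
    have y'_eq: "potential \<beta> y' = (1 - t) * Gy + t * Gz"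
      using potential_eq_grad[of y'] pos
      by (simp add: y'_def Gy_def Gz_def g_def[symmetric] sum.distrib sum_distrib_left distrib_right mult.assoc)
    have "potential \<beta> y \<le> Gy"
      unfolding Gy_def g_def using pos by (intro potential_le_grad) auto
    with y_max[OF y'] y'_eq have "t * Gz \<le> t * (Gy + \<tau>)"
      by (simp add: algebra_simps)
    then have "Gz \<le> Gy + \<tau>" using t by simp
    moreover have "0 \<le> Gz"
      unfolding Gz_def using pos g_nonneg by (intro sum_nonneg mult_nonneg_nonneg) (auto simp: less_imp_le)
    moreover have "potential \<beta> y' \<le> ?T"
      using y' pos by (intro potential_le_expected_opt) (auto simp: \<Delta>_def)
    \<comment> \<open>As \<open>Gz\<close> is nonnegative, (1 - t) Gy is at most the potential at
      \<open>y'\<close>, hence at most the expected optimum.\<close>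
    ultimately have "Gz \<le> ?T / (1 - t) + \<tau>"
      using y'_eq t by (smt (verit) mult_nonneg_nonneg pos_le_divide_eq mult.commute)
    moreover have "(1 - real m * \<delta>) * g k \<le> Gz"
    proof -
      have "(1 - real m * \<delta>) * g k \<le> z k * g k"
        using \<delta> g_nonneg[OF \<open>k < m\<close>] by (intro mult_right_mono) (auto simp: z_def)
      also have "\<dots> \<le> Gz"
        unfolding Gz_def using pos g_nonneg \<open>k < m\<close>
        by (intro member_le_sum[of k "{..<m}" "\<lambda>i. z i * g i"]) (auto simp: less_imp_le)
      finally show ?thesis .
    qed
    ultimately have g_le: "g k \<le> (?T / (1 - t) + \<tau>) / (1 - real m * \<delta>)"
      using \<delta> by (simp add: field_simps)
    \<comment> \<open>The bound on \<open>g k\<close> holds at \<open>y'\<close>, which depends on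
      \<open>k\<close>. Comparing the weights of \<open>y\<close> and \<open>y'\<close> carries it
      back to \<open>y\<close>, so that one vector serves all agents. The floor
      \<open>\<delta>\<close> enters through z i \<le> 1 \<le> y i / \<delta>.\<close>
    have upper: "y i powr - (\<beta> + 1) \<le> (1 + t / \<delta>) powr (\<beta> + 1) * y' i powr - (\<beta> + 1)" if "i < m" for i
    proof -
      have "1 \<le> y i / \<delta>"
        using y(1) \<delta> that by (simp add: \<Delta>_def)
      then have "z i \<le> y i / \<delta>"
        using \<Delta>_le[OF z that] by linarith
      then have "y' i \<le> y i + t * (y i / \<delta>)"
        unfolding y'_def using t pos(1)[OF that] by (intro add_mono mult_left_mono) auto
      also have "\<dots> = (1 + t / \<delta>) * y i" by (simp add: algebra_simps)
      finally have "y' i \<le> (1 + t / \<delta>) * y i" .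
      then have "y' i powr (\<beta> + 1) \<le> (1 + t / \<delta>) powr (\<beta> + 1) * y i powr (\<beta> + 1)"
        using pos(2)[OF that] \<beta> t \<delta> pos(1)[OF that] by (subst powr_mult[symmetric]) (auto intro!: powr_mono2)
      then show ?thesis
        unfolding powr_minus_divide using pos(1)[OF that] pos(2)[OF that] by (simp add: field_simps)
    qed
    have lower: "y' i powr - (\<beta> + 1) \<le> (1 - t) powr - (\<beta> + 1) * y i powr - (\<beta> + 1)" if "i < m" for i
    proof -
      have "(1 - t) * y i \<le> y' i"
        using t pos(3)[OF that] by (simp add: y'_def)
      then have "y' i powr - (\<beta> + 1) \<le> ((1 - t) * y i) powr - (\<beta> + 1)"
        using pos(1)[OF that] t \<beta> by (intro powr_mono2') auto
      also have "\<dots> = (1 - t) powr - (\<beta> + 1) * y i powr - (\<beta> + 1)"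
        by (rule powr_mult)
      finally show ?thesis .
    qed
    have "mean_load m n D (- (\<beta> + 1)) (\<lambda>i. y i powr - (\<beta> + 1)) k
      \<le> (1 + t / \<delta>) powr (\<beta> + 1) * (1 - t) powr - (\<beta> + 1)
        * mean_load m n D (- (\<beta> + 1)) (\<lambda>i. y' i powr - (\<beta> + 1)) k"
      using upper lower pos \<open>k < m\<close> by (intro mean_load_perturb) (auto simp: less_imp_neq[symmetric])
    also have "(1 + t / \<delta>) powr (\<beta> + 1) * (1 - t) powr - (\<beta> + 1) = ((1 + t / \<delta>) / (1 - t)) powr (\<beta> + 1)"
      unfolding powr_minus_divide using t \<delta> by (simp add: powr_divide)
    also have "mean_load m n D (- (\<beta> + 1)) (\<lambda>i. y' i powr - (\<beta> + 1)) k \<le> real m powr (1 / \<beta>) * g k"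
      unfolding g_def using pos \<open>k < m\<close> by (intro mean_load_le_grad) auto
    also have "\<dots> \<le> real m powr (1 / \<beta>) * ((?T / (1 - t) + \<tau>) / (1 - real m * \<delta>))"
      using g_le by (intro mult_left_mono) auto
    finally show ?thesis by (simp add: mult_left_mono)
  qed
  then show ?thesis
    using y \<Delta>_le by (intro exI[of _ y]) (auto simp: \<Delta>_def)
qed

end

end

section \<open>The empirical minimiser\<close>

lemma inverse_one_minus_le_exp:
  fixes t :: real
  assumes "0 \<le> t" "t \<le> 1 / 2"
  shows "1 / (1 - t) \<le> exp (2 * t)"
proof -
  have "t * t \<le> t * (1 / 2)" using assms by (intro mult_left_mono) auto
  then have "1 \<le> (1 + 2 * t) * (1 - t)" by (simp add: algebra_simps)
  also have "\<dots> \<le> exp (2 * t) * (1 - t)"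
    using assms by (intro mult_right_mono exp_ge_add_one_self) auto
  finally show ?thesis using assms by (simp add: field_simps)
qed

text \<open>An additive loss of \<epsilon> is booked as one more factor exp \<epsilon>, so losses
  can be counted by the coefficient of \<epsilon> in the exponent.\<close>

lemma exp_plus_le_exp_shift:
  fixes q \<epsilon> :: real
  assumes "0 \<le> q" "0 \<le> \<epsilon>"
  shows "exp (q * \<epsilon>) + \<epsilon> \<le> exp ((q + 1) * \<epsilon>)"
proof -
  have "1 * \<epsilon> \<le> exp (q * \<epsilon>) * (exp \<epsilon> - 1)"
  proof (rule mult_mono)
    show "\<epsilon> \<le> exp \<epsilon> - 1" using exp_ge_add_one_self[of \<epsilon>] by linarith
  qed (use assms in auto)
  then show ?thesis by (simp add: algebra_simps flip: exp_add)
qed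

section \<open>A geometric net of weight vectors and minimisation over it\<close>

definition weight_net :: "nat \<Rightarrow> real \<Rightarrow> nat \<Rightarrow> (nat \<Rightarrow> real) set" where
  "weight_net m \<epsilon> K = {..<m} \<rightarrow>\<^sub>E (\<lambda>k. exp (\<epsilon> * real k)) ` {..K}"

lemma weight_net_subset: "weight_net m \<epsilon> K \<subseteq> pos_vecs m"
  unfolding weight_net_def pos_vecs_def by (intro PiE_mono) auto

lemma weight_net_pos: "w \<in> weight_net m \<epsilon> K \<Longrightarrow> i < m \<Longrightarrow> 0 < w i"
  using weight_net_subset by (fastforce simp: pos_vecs_def)

lemma finite_weight_net: "finite (weight_net m \<epsilon> K)"
  unfolding weight_net_def by (intro finite_PiE) auto

lemma weight_net_nonempty: "weight_net m \<epsilon> K \<noteq> {}"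
  by (simp add: weight_net_def PiE_eq_empty_iff)

lemma card_weight_net: "card (weight_net m \<epsilon> K) \<le> (K + 1) ^ m"
proof -
  have "card (weight_net m \<epsilon> K) = card ((\<lambda>k. exp (\<epsilon> * real k)) ` {..K}) ^ m"
    by (simp add: weight_net_def card_PiE)
  also have "\<dots> \<le> (K + 1) ^ m"
    using card_image_le[of "{..K}" "\<lambda>k. exp (\<epsilon> * real k)"] by (intro power_mono) auto
  finally show ?thesis .
qed

text \<open>The sum over the samples, not their average; thresholds therefore carry the factor
  \<open>N\<close>.\<close>

definition empirical_load :: "nat \<Rightarrow> nat \<Rightarrow> real \<Rightarrow> weights list \<Rightarrow> (nat \<Rightarrow> real) \<Rightarrow> nat \<Rightarrow> real" where
  "empirical_load m n \<alpha> Ps w i = (\<Sum>P\<leftarrow>Ps. prop_load m n \<alpha> w P i)"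

definition empirical_min ::
  "nat \<Rightarrow> nat \<Rightarrow> real \<Rightarrow> (nat \<Rightarrow> real) set \<Rightarrow> weights list \<Rightarrow> nat \<Rightarrow> real" where
  "empirical_min m n \<alpha> W Ps = arg_min_on (\<lambda>w. MAX i\<in>{..<m}. empirical_load m n \<alpha> Ps w i) W"

lemma empirical_min_in:
  "finite W \<Longrightarrow> W \<noteq> {} \<Longrightarrow> empirical_min m n \<alpha> W Ps \<in> W"
  unfolding empirical_min_def by (rule arg_min_if_finite)

lemma empirical_min_le:
  assumes "finite W" "w \<in> W"
  shows "(MAX i\<in>{..<m}. empirical_load m n \<alpha> Ps (empirical_min m n \<alpha> W Ps) i)
    \<le> (MAX i\<in>{..<m}. empirical_load m n \<alpha> Ps w i)"
  unfolding empirical_min_def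
  using assms arg_min_least[of W w "\<lambda>w. MAX i\<in>{..<m}. empirical_load m n \<alpha> Ps w i"] by auto

section \<open>Concentration of empirical loads and the expected maximum\<close>

context bounded_columns
begin

text \<open>For positive \<open>c\<close> this is an upper tail, for negative \<open>c\<close> a
  lower tail. By \<open>exp_sub_one_le\<close> the rate (exp (c b) - 1) / b is at most c exp (c b)
  for either sign, so the mean is distorted by the factor exp (c b) only.\<close>

lemma empirical_load_tail:
  assumes w: "\<And>i. i < m \<Longrightarrow> 0 < w i" and "i < m"
  shows "measure_pmf.prob (replicate_pmf N (instance_pmf n D)) {Ps. real N * (c * \<theta>) \<le> c * empirical_load m n \<alpha> Ps w i}
    \<le> exp (real N * (c * (exp (c * b) * mean_load m n D \<alpha> w i - \<theta>)))"
proof -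
  let ?\<mu> = "mean_load m n D \<alpha> w i"
  let ?E = "measure_pmf.expectation (instance_pmf n D) (\<lambda>P. exp (c * prop_load m n \<alpha> w P i))"
  have "(exp (c * b) - 1) / b * ?\<mu> \<le> (c * b * exp (c * b)) / b * ?\<mu>"
    using b_pos mean_load_nonneg[of w i \<alpha>] w \<open>i < m\<close>
    by (intro mult_right_mono divide_right_mono exp_sub_one_le) auto
  also have "\<dots> = c * exp (c * b) * ?\<mu>"
    using b_pos by simp
  finally have "?E \<le> exp (c * exp (c * b) * ?\<mu>)"
    using mgf_prop_load_le[of w i c \<alpha>] w \<open>i < m\<close> by (meson exp_le_cancel_iff order_trans)
  then have E: "?E ^ N \<le> exp (c * exp (c * b) * ?\<mu>) ^ N"
    by (intro power_mono) auto
  have "measure_pmf.prob (replicate_pmf N (instance_pmf n D))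
      {Ps. real N * (c * \<theta>) \<le> (\<Sum>P\<leftarrow>Ps. c * prop_load m n \<alpha> w P i)}
    \<le> exp (- (real N * (c * \<theta>))) * ?E ^ N"
    using w \<open>i < m\<close> by (intro replicate_pmf_chernoff integrable_exp_prop_load)
  also have "\<dots> \<le> exp (- (real N * (c * \<theta>))) * exp (c * exp (c * b) * ?\<mu>) ^ N"
    using E by (intro mult_left_mono) auto
  also have "\<dots> = exp (real N * (c * (exp (c * b) * ?\<mu> - \<theta>)))"
    by (simp add: algebra_simps flip: exp_of_nat_mult exp_add)
  finally show ?thesis
    by (simp add: empirical_load_def sum_list_const_mult)
qed

text \<open>From 1 + z \<le> exp z, the maximum is at most a + (exp (- c a) h - 1) / c for every
  \<open>a\<close>, where \<open>h\<close> is the sum of the exponentials of the scaled loads. This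
  is linear in \<open>h\<close>, so expectations can be taken term by term.\<close>

lemma expectation_max_load_le:
  assumes w: "\<And>i. i < m \<Longrightarrow> 0 < w i" and "0 < c"
    and \<mu>: "\<And>i. i < m \<Longrightarrow> mean_load m n D \<alpha> w i \<le> \<mu>"
  shows "measure_pmf.expectation (instance_pmf n D) (\<lambda>P. max_load m n P (prop_alloc m P \<alpha> w))
    \<le> ln (real m) / c + exp (c * b) * \<mu>"
proof -
  let ?E = "measure_pmf.expectation (instance_pmf n D)"
  \<comment> \<open>Chosen so that exp (- c a) times the bound on the expectation of
    \<open>h\<close>, which is m exp (c exp (c b) \<mu>), equals 1; the correction term then drops
    out.\<close>
  define a where "a = ln (real m) / c + exp (c * b) * \<mu>"
  have integrable_exp: "integrable (measure_pmf (instance_pmf n D)) (\<lambda>P. exp (c * prop_load m n \<alpha> w P i))"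
    if "i < m" for i
    using w that by (intro integrable_exp_prop_load)
  define h where "h P = (\<Sum>i<m. exp (c * prop_load m n \<alpha> w P i))" for P
  have integrable_h: "integrable (measure_pmf (instance_pmf n D)) h"
    unfolding h_def using integrable_exp by (intro Bochner_Integration.integrable_sum) auto
  have E_h: "?E h = (\<Sum>i<m. ?E (\<lambda>P. exp (c * prop_load m n \<alpha> w P i)))"
    unfolding h_def using integrable_exp by (intro Bochner_Integration.integral_sum) auto
  have mgf: "?E (\<lambda>P. exp (c * prop_load m n \<alpha> w P i)) \<le> exp (c * (exp (c * b) * \<mu>))" if "i < m" for i
  proof -
    have "(exp (c * b) - 1) / b * mean_load m n D \<alpha> w i \<le> (c * b * exp (c * b)) / b * \<mu>"
      using b_pos mean_load_nonneg[of w i \<alpha>] w \<open>i < m\<close> \<mu> \<open>0 < c\<close>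
      by (intro mult_mono divide_right_mono exp_sub_one_le) auto
    also have "\<dots> = c * (exp (c * b) * \<mu>)"
      using b_pos by simp
    finally show ?thesis
      using mgf_prop_load_le[of w i c \<alpha>] w \<open>i < m\<close> by (meson exp_le_cancel_iff order_trans)
  qed
  have "?E (\<lambda>P. max_load m n P (prop_alloc m P \<alpha> w))
    \<le> ?E (\<lambda>P. a + (exp (- (c * a)) * h P - 1) / c)"
  proof (rule expectation_pmf_mono)
    have loads: "max_load m n P (prop_alloc m P \<alpha> w) \<in> prop_load m n \<alpha> w P ` {..<m}" for P
      unfolding max_load_def prop_load_def using m_pos by (intro Max_in) auto
    show "integrable (measure_pmf (instance_pmf n D)) (\<lambda>P. max_load m n P (prop_alloc m P \<alpha> w))"
    proof (rule integrable_pmf_bounded[where B = "real n * b"])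
      fix P assume P: "P \<in> set_pmf (instance_pmf n D)"
      obtain i where "i < m" "max_load m n P (prop_alloc m P \<alpha> w) = prop_load m n \<alpha> w P i"
        using loads[of P] by auto
      then show "\<bar>max_load m n P (prop_alloc m P \<alpha> w)\<bar> \<le> real n * b"
        using prop_load_bounds[of P w i \<alpha>] P w by auto
    qed
    show "integrable (measure_pmf (instance_pmf n D))
        (\<lambda>P. a + (exp (- (c * a)) * h P - 1) / c)"
      using integrable_h by simp
    fix P
    obtain i where i: "i < m" "max_load m n P (prop_alloc m P \<alpha> w) = prop_load m n \<alpha> w P i"
      using loads[of P] by auto
    have "1 + (c * prop_load m n \<alpha> w P i - c * a) \<le> exp (- (c * a)) * exp (c * prop_load m n \<alpha> w P i)"
      using exp_ge_add_one_self[of "c * prop_load m n \<alpha> w P i - c * a"] by (simp add: exp_diff exp_minus field_simps)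
    also have "\<dots> \<le> exp (- (c * a)) * h P"
      unfolding h_def using i by (intro mult_left_mono member_le_sum[of i "{..<m}" "\<lambda>i. exp (c * prop_load m n \<alpha> w P i)"]) auto
    finally show "max_load m n P (prop_alloc m P \<alpha> w)
      \<le> a + (exp (- (c * a)) * h P - 1) / c"
      unfolding i(2) using \<open>0 < c\<close> by (simp add: field_simps)
  qed
  also have "\<dots> = a + (exp (- (c * a)) * (\<Sum>i<m. ?E (\<lambda>P. exp (c * prop_load m n \<alpha> w P i))) - 1) / c"
    using integrable_h by (simp add: E_h)
  also have "\<dots> \<le> a + (exp (- (c * a)) * (\<Sum>i<m. exp (c * (exp (c * b) * \<mu>))) - 1) / c"
    using mgf \<open>0 < c\<close> by (intro add_left_mono divide_right_mono diff_right_mono mult_left_mono sum_mono) auto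
  also have "\<dots> = a"
    using m_pos \<open>0 < c\<close> by (simp add: a_def distrib_left exp_add exp_minus exp_diff)
  finally show ?thesis by (simp add: a_def)
qed

text \<open>A threshold separates the good reference vector \<open>w0\<close>, all of whose
  empirical loads stay below it, from every bad vector of \<open>W\<close>, which has some empirical
  load above it. The empirical minimiser does no worse than \<open>w0\<close>, so it is not
  bad.\<close>

lemma empirical_min_correct:
  assumes W: "finite W" "\<And>w i. w \<in> W \<Longrightarrow> i < m \<Longrightarrow> 0 < w i"
    and T: "T = b * ln (real m) / \<epsilon>\<^sup>2" "0 \<le> T" and \<epsilon>: "0 < \<epsilon>" and q: "0 \<le> q"
    and w0: "w0 \<in> W" "\<And>i. i < m \<Longrightarrow> mean_load m n D \<alpha> w0 i \<le> exp (q * \<epsilon>) * T"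
  shows "measure_pmf.prob (replicate_pmf N (instance_pmf n D))
      {Ps. \<forall>i<m. mean_load m n D \<alpha> (empirical_min m n \<alpha> W Ps) i \<le> exp ((q + 4) * \<epsilon>) * T}
    \<ge> 1 - (real (card W) + real m) * exp (- (real N * ln (real m)))"
proof -
  let ?prob = "measure_pmf.prob (replicate_pmf N (instance_pmf n D))"
  let ?e = "exp (- (real N * ln (real m)))"
  let ?load = "\<lambda>Ps. empirical_load m n \<alpha> Ps"
  let ?mean = "mean_load m n D \<alpha>"
  \<comment> \<open>From \<open>w0\<close>, one factor exp \<epsilon> pays for the moment generating
    function and one for the gap \<epsilon> T, giving q + 2. The same two losses below a bad mean
    lead from q + 4 down to q + 2.\<close>
  define \<theta> where "\<theta> = exp ((q + 2) * \<epsilon>) * T"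
  \<comment> \<open>With this \<open>c\<close> the distortion exp (c b) is exp \<epsilon>, and by
    the relation between \<open>T\<close> and \<open>b\<close> the gap \<epsilon> T contributes
    exactly ln m per sample to the exponent.\<close>
  define c where "c = \<epsilon> / b"
  have c: "0 < c" "c * b = \<epsilon>" "c * (\<epsilon> * T) = ln (real m)"
    using b_pos \<epsilon> by (auto simp: c_def T power2_eq_square)
  have step: "exp (p * \<epsilon>) * T + \<epsilon> * T \<le> exp ((p + 1) * \<epsilon>) * T" if "0 \<le> p" for p
    using mult_right_mono[OF exp_plus_le_exp_shift[OF that, of \<epsilon>] \<open>0 \<le> T\<close>] \<epsilon> by (simp add: distrib_right)
  define bad where "bad w i \<longleftrightarrow> i < m \<and> exp ((q + 4) * \<epsilon>) * T < ?mean w i" for w i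
  define U where "U = (\<Union>i<m. {Ps. real N * \<theta> \<le> ?load Ps w0 i})"
  \<comment> \<open>One overloaded agent is fixed for each bad vector before sampling. A single
    lower tail per vector then suffices, and the union bound has at most card W + m events.\<close>
  define idx where "idx w = (SOME i. bad w i)" for w
  have idx: "bad w (idx w)" if "\<exists>i. bad w i" for w
    using someI_ex[OF that] by (simp add: idx_def)
  define W' where "W' = {w \<in> W. \<exists>i. bad w i}"
  define L where "L = (\<Union>w\<in>W'. {Ps. ?load Ps w (idx w) \<le> real N * \<theta>})"
  have good: "?mean (empirical_min m n \<alpha> W Ps) i \<le> exp ((q + 4) * \<epsilon>) * T"
    if "Ps \<notin> U \<union> L" "i < m" for Ps i
  proof (rule ccontr)
    let ?w = "empirical_min m n \<alpha> W Ps"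
    assume "\<not> ?thesis"
    with \<open>i < m\<close> have "\<exists>i. bad ?w i" by (auto simp: bad_def)
    moreover have "?w \<in> W" using W w0 by (intro empirical_min_in) auto
    ultimately have "?w \<in> W'" "idx ?w < m" using idx[of ?w] by (auto simp: W'_def bad_def)
    with that have "real N * \<theta> < ?load Ps ?w (idx ?w)" by (auto simp: L_def not_le)
    also have "\<dots> \<le> (MAX i\<in>{..<m}. ?load Ps ?w i)"
      using \<open>idx ?w < m\<close> by (intro Max_ge) auto
    also have "\<dots> \<le> (MAX i\<in>{..<m}. ?load Ps w0 i)"
      using W w0 by (intro empirical_min_le) auto
    also have "\<dots> < real N * \<theta>"
      using that m_pos by (subst Max_less_iff) (auto simp: U_def not_le)
    finally show False .
  qed
  have "?prob {Ps. real N * \<theta> \<le> ?load Ps w0 i} \<le> ?e" if "i < m" for i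
  proof -
    have "?prob {Ps. real N * (c * \<theta>) \<le> c * ?load Ps w0 i}
        \<le> exp (real N * (c * (exp (c * b) * ?mean w0 i - \<theta>)))"
      using W(2)[OF w0(1)] that by (intro empirical_load_tail)
    moreover have "c * (exp (c * b) * ?mean w0 i - \<theta>) \<le> c * (- (\<epsilon> * T))"
    proof (intro mult_left_mono)
      have "exp (c * b) * ?mean w0 i \<le> exp \<epsilon> * (exp (q * \<epsilon>) * T)"
        unfolding c using w0(2)[OF that] by (intro mult_left_mono) auto
      also have "\<dots> = exp ((q + 1) * \<epsilon>) * T" by (simp add: distrib_right exp_add)
      also have "\<dots> \<le> \<theta> - \<epsilon> * T"
        using step[of "q + 1"] q by (simp add: \<theta>_def algebra_simps)
      finally show "exp (c * b) * ?mean w0 i - \<theta> \<le> - (\<epsilon> * T)" by simp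
    qed (use c in simp)
    then have "real N * (c * (exp (c * b) * ?mean w0 i - \<theta>)) \<le> real N * - ln (real m)"
      using c(3) by (intro mult_left_mono) auto
    then have "exp (real N * (c * (exp (c * b) * ?mean w0 i - \<theta>))) \<le> ?e"
      by simp
    ultimately have "?prob {Ps. real N * (c * \<theta>) \<le> c * ?load Ps w0 i} \<le> ?e"
      by (rule order_trans)
    moreover have "{Ps. real N * (c * \<theta>) \<le> c * ?load Ps w0 i} = {Ps. real N * \<theta> \<le> ?load Ps w0 i}"
      using c(1) by (simp add: mult.left_commute)
    ultimately show ?thesis by (simp only:)
  qed
  then have "?prob U \<le> (\<Sum>i<m. ?e)"
    unfolding U_def
    by (intro order_trans[OF measure_pmf.finite_measure_subadditive_finite] sum_mono) auto
  \<comment> \<open>The lower tail is the same estimate with \<open>- c\<close>.\<close>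
  moreover have "?prob {Ps. ?load Ps w (idx w) \<le> real N * \<theta>} \<le> ?e" if "w \<in> W'" for w
  proof -
    from that have w: "w \<in> W" "idx w < m" "exp ((q + 4) * \<epsilon>) * T < ?mean w (idx w)"
      using idx[of w] by (auto simp: W'_def bad_def)
    have "?prob {Ps. real N * (- c * \<theta>) \<le> - c * ?load Ps w (idx w)}
        \<le> exp (real N * (- c * (exp (- c * b) * ?mean w (idx w) - \<theta>)))"
      using W(2)[OF w(1)] w(2) by (intro empirical_load_tail)
    moreover have "- c * (exp (- c * b) * ?mean w (idx w) - \<theta>) \<le> - c * (\<epsilon> * T)"
    proof (intro mult_left_mono_neg)
      have "\<theta> + \<epsilon> * T \<le> exp ((q + 3) * \<epsilon>) * T"
        using step[of "q + 2"] q by (simp add: \<theta>_def algebra_simps)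
      also have "\<dots> = exp (- \<epsilon>) * (exp ((q + 4) * \<epsilon>) * T)" by (simp add: algebra_simps flip: exp_add)
      also have "\<dots> \<le> exp (- c * b) * ?mean w (idx w)"
        using c(2) w(3) by (simp add: mult_left_mono)
      finally show "\<epsilon> * T \<le> exp (- c * b) * ?mean w (idx w) - \<theta>" by simp
    qed (use c in simp)
    then have "real N * (- c * (exp (- c * b) * ?mean w (idx w) - \<theta>)) \<le> real N * - ln (real m)"
      using c(3) by (intro mult_left_mono) auto
    then have "exp (real N * (- c * (exp (- c * b) * ?mean w (idx w) - \<theta>))) \<le> ?e"
      by simp
    ultimately have "?prob {Ps. real N * (- c * \<theta>) \<le> - c * ?load Ps w (idx w)} \<le> ?e"
      by (rule order_trans)
    moreover have "{Ps. real N * (- c * \<theta>) \<le> - c * ?load Ps w (idx w)} = {Ps. ?load Ps w (idx w) \<le> real N * \<theta>}"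
      using c(1) by (simp add: mult.left_commute)
    ultimately show ?thesis by (simp only:)
  qed
  then have "?prob L \<le> (\<Sum>w\<in>W'. ?e)"
    unfolding L_def using W by (intro order_trans[OF measure_pmf.finite_measure_subadditive_finite] sum_mono)
      (auto simp: W'_def)
  moreover have "(\<Sum>w\<in>W'. ?e) \<le> real (card W) * ?e"
    using W by (auto simp: W'_def intro!: mult_right_mono card_mono)
  moreover have "?prob (U \<union> L) \<le> ?prob U + ?prob L"
    by (intro measure_Un_le) auto
  ultimately have "?prob (U \<union> L) \<le> (\<Sum>i<m. ?e) + real (card W) * ?e"
    by linarith
  then have "?prob (U \<union> L) \<le> (real (card W) + real m) * ?e"
    by (simp add: algebra_simps)
  moreover have "1 - ?prob (U \<union> L) = ?prob (- (U \<union> L))"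
    using measure_pmf.prob_compl[of "U \<union> L"] by (simp add: Compl_eq_Diff_UNIV)
  moreover have "?prob (- (U \<union> L)) \<le> ?prob {Ps. \<forall>i<m. ?mean (empirical_min m n \<alpha> W Ps) i \<le> exp ((q + 4) * \<epsilon>) * T}"
    using good by (intro measure_pmf.finite_measure_mono) auto
  ultimately show ?thesis by linarith
qed

end

section \<open>Parameter choice, rounding into the net, and a fresh instance\<close>

context bounded_columns
begin

text \<open>Six factors exp \<epsilon> are spent: one on the step \<open>t\<close>
  (\<open>f1\<close>), one on \<open>m powr (1 / \<beta>)\<close> (\<open>f2\<close>), three on 1 /
  (1 - t), the slack \<epsilon> T and the truncation (\<open>f3\<close>), and one on rounding to the
  net.\<close>

lemma ex_weight_net:
  fixes \<epsilon> :: real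
  defines "\<beta> \<equiv> ln (real m) / \<epsilon>"
  defines "K \<equiv> nat \<lfloor>(\<beta> + 1) * ln (2 * real m / \<epsilon>) / \<epsilon>\<rfloor>"
  assumes m: "2 \<le> m" and \<epsilon>: "0 < \<epsilon>" "\<epsilon> < 1" and T: "0 < expected_opt m n D"
  shows "\<exists>w\<in>weight_net m \<epsilon> K. \<forall>i<m. mean_load m n D (- (\<beta> + 1)) w i \<le> exp (6 * \<epsilon>) * expected_opt m n D"
proof -
  let ?T = "expected_opt m n D"
  define \<gamma> where "\<gamma> = \<beta> + 1"
  \<comment> \<open>The truncation costs mass m \<delta> = \<epsilon> / 2. Then \<open>t\<close>
    makes t / \<delta> and 2 t each at most \<epsilon> / (4 \<gamma>), so that the power
    \<open>\<gamma>\<close> of (1 + t / \<delta>) / (1 - t) stays below exp \<epsilon>.\<close>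
  define \<delta> where "\<delta> = \<epsilon> / (2 * real m)"
  define t where "t = \<delta> * \<epsilon> / (4 * \<gamma>)"
  have \<beta>: "0 < \<beta>" using m \<epsilon> by (simp add: \<beta>_def)
  have \<gamma>: "1 \<le> \<gamma>" using \<beta> by (simp add: \<gamma>_def)
  have "\<epsilon> \<le> real m"
    using m \<epsilon> by linarith
  then have \<delta>: "0 < \<delta>" "\<delta> \<le> 1 / 2" "real m * \<delta> = \<epsilon> / 2"
    using m \<epsilon> by (auto simp: \<delta>_def field_simps)
  have t_div: "t / \<delta> = \<epsilon> / (4 * \<gamma>)" using \<delta> by (simp add: t_def)
  have t_pos: "0 < t" using \<delta> \<epsilon> \<gamma> by (simp add: t_def)
  have "t = \<delta> * (t / \<delta>)" using \<delta> by simp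
  also have "\<dots> \<le> 1 / 2 * (t / \<delta>)" using \<delta> t_pos by (intro mult_right_mono) auto
  finally have t2: "2 * t \<le> \<epsilon> / (4 * \<gamma>)" by (simp add: t_div)
  have "\<epsilon> / (4 * \<gamma>) \<le> \<epsilon> / 4" using \<gamma> \<epsilon> by (intro divide_left_mono) auto
  with t2 \<epsilon> have t: "0 < t" "2 * t \<le> \<epsilon>" "t \<le> 1 / 2" using t_pos by auto
  obtain y where y: "\<And>i. i < m \<Longrightarrow> \<delta> \<le> y i \<and> y i \<le> 1"
    and y_load: "\<And>k. k < m \<Longrightarrow> mean_load m n D (- \<gamma>) (\<lambda>i. y i powr - \<gamma>) k
      \<le> ((1 + t / \<delta>) / (1 - t)) powr \<gamma> * (real m powr (1 / \<beta>) * ((?T / (1 - t) + \<epsilon> * ?T) / (1 - real m * \<delta>)))"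
    using ex_multipliers[OF \<beta>, of t "\<epsilon> * ?T" \<delta>] t \<epsilon> T \<delta> unfolding \<gamma>_def by auto
  have "(1 + t / \<delta>) / (1 - t) \<le> exp (t / \<delta>) * exp (2 * t)"
    using mult_mono[OF exp_ge_add_one_self[of "t / \<delta>"] inverse_one_minus_le_exp[of t]] t \<delta> by simp
  also have "\<dots> \<le> exp (\<epsilon> / \<gamma>)"
    using t2 t_div \<gamma> \<epsilon> by (simp add: field_simps flip: exp_add)
  finally have "((1 + t / \<delta>) / (1 - t)) powr \<gamma> \<le> exp (\<epsilon> / \<gamma>) powr \<gamma>"
    using \<gamma> t \<delta> by (intro powr_mono2) auto
  then have f1: "((1 + t / \<delta>) / (1 - t)) powr \<gamma> \<le> exp \<epsilon>"
    using \<gamma> by (simp add: powr_def)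
  have f2: "real m powr (1 / \<beta>) = exp \<epsilon>"
    using m by (simp add: powr_def \<beta>_def)
  have "1 / (1 - t) \<le> exp \<epsilon>"
    using inverse_one_minus_le_exp[of t] t by (smt (verit) exp_le_cancel_iff)
  then have "?T * (1 / (1 - t)) + \<epsilon> * ?T \<le> ?T * exp \<epsilon> + \<epsilon> * ?T"
    using T by (intro add_right_mono mult_left_mono) auto
  also have "\<dots> = (exp (1 * \<epsilon>) + \<epsilon>) * ?T" by (simp add: algebra_simps)
  also have "\<dots> \<le> exp (2 * \<epsilon>) * ?T"
    using exp_plus_le_exp_shift[of 1 \<epsilon>] \<epsilon> T by (intro mult_right_mono) auto
  finally have "?T / (1 - t) + \<epsilon> * ?T \<le> exp (2 * \<epsilon>) * ?T" by simp
  moreover have f4: "1 / (1 - real m * \<delta>) \<le> exp \<epsilon>"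
    unfolding \<delta>(3) using inverse_one_minus_le_exp[of "\<epsilon> / 2"] \<epsilon> by simp
  ultimately have "(?T / (1 - t) + \<epsilon> * ?T) * (1 / (1 - real m * \<delta>)) \<le> exp (2 * \<epsilon>) * ?T * exp \<epsilon>"
    using \<delta> \<epsilon> T by (intro mult_mono) auto
  then have f3: "(?T / (1 - t) + \<epsilon> * ?T) / (1 - real m * \<delta>) \<le> exp (2 * \<epsilon>) * ?T * exp \<epsilon>"
    by simp
  have y_mean: "mean_load m n D (- \<gamma>) (\<lambda>i. y i powr - \<gamma>) k \<le> exp (5 * \<epsilon>) * ?T" if "k < m" for k
  proof -
    note y_load[OF that]
    also have "((1 + t / \<delta>) / (1 - t)) powr \<gamma> * (real m powr (1 / \<beta>) * ((?T / (1 - t) + \<epsilon> * ?T) / (1 - real m * \<delta>)))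
      \<le> exp \<epsilon> * (exp \<epsilon> * (exp (2 * \<epsilon>) * ?T * exp \<epsilon>))"
      unfolding f2 using f1 f3 t \<delta> T \<epsilon> by (intro mult_mono) auto
    also have "\<dots> = exp (5 * \<epsilon>) * ?T"
      by (simp add: mult_ac flip: exp_add)
    finally show ?thesis .
  qed
  \<comment> \<open>Each weight is rounded down to a power of exp \<epsilon>. Its logarithm is
    nonnegative since y i \<le> 1, so \<open>nat\<close> loses nothing, and y i \<ge> \<delta>
    bounds it by \<gamma> ln (2 m / \<epsilon>), which explains \<open>K\<close>.\<close>
  define w where "w = (\<lambda>i\<in>{..<m}. exp (\<epsilon> * real (nat \<lfloor>ln (y i powr - \<gamma>) / \<epsilon>\<rfloor>)))"
  have y_pos: "0 < y i" if "i < m" for i using y[OF that] \<delta> by simp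
  have ln_eq: "ln (y i powr - \<gamma>) = \<gamma> * - ln (y i)" if "i < m" for i
    using y_pos[OF that] by (simp add: ln_powr)
  have ln_nonneg: "0 \<le> ln (y i powr - \<gamma>) / \<epsilon>" if "i < m" for i
    unfolding ln_eq[OF that] using y[OF that] y_pos[OF that] \<gamma> \<epsilon>
    by (intro divide_nonneg_pos mult_nonneg_nonneg) auto
  have "nat \<lfloor>ln (y i powr - \<gamma>) / \<epsilon>\<rfloor> \<le> K" if "i < m" for i
  proof -
    have "- ln (y i) \<le> - ln \<delta>"
      using y[OF that] \<delta> by simp
    also have "\<dots> = ln (2 * real m / \<epsilon>)"
      using m \<epsilon> by (simp add: \<delta>_def ln_div)
    finally have "\<gamma> * - ln (y i) / \<epsilon> \<le> \<gamma> * ln (2 * real m / \<epsilon>) / \<epsilon>"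
      using \<gamma> \<epsilon> by (intro divide_right_mono mult_left_mono) auto
    then show ?thesis
      unfolding K_def \<gamma>_def[symmetric] ln_eq[OF that] by (intro nat_mono floor_mono)
  qed
  then have "w \<in> weight_net m \<epsilon> K"
    by (auto simp: weight_net_def w_def)
  moreover have "mean_load m n D (- (\<beta> + 1)) w k \<le> exp (6 * \<epsilon>) * ?T" if "k < m" for k
  proof -
    have w_pos: "0 < w i" if "i < m" for i
      using that by (simp add: w_def)
    have y_eq: "y i powr - \<gamma> = exp (\<epsilon> * (ln (y i powr - \<gamma>) / \<epsilon>))" if "i < m" for i
      using y_pos[OF that] \<epsilon> by (simp add: powr_def)
    have floor: "real (nat \<lfloor>ln (y i powr - \<gamma>) / \<epsilon>\<rfloor>) = of_int \<lfloor>ln (y i powr - \<gamma>) / \<epsilon>\<rfloor>" if "i < m" for i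
      using ln_nonneg[OF that] by simp
    have le: "w i \<le> 1 * y i powr - \<gamma>" if "i < m" for i
    proof -
      have "\<epsilon> * of_int \<lfloor>ln (y i powr - \<gamma>) / \<epsilon>\<rfloor> \<le> \<epsilon> * (ln (y i powr - \<gamma>) / \<epsilon>)"
        using \<epsilon> by (intro mult_left_mono of_int_floor_le) auto
      then show ?thesis
        using that floor[OF that] by (subst y_eq[OF that]) (simp add: w_def del: of_nat_nat)
    qed
    have ge: "y i powr - \<gamma> \<le> exp \<epsilon> * w i" if "i < m" for i
    proof -
      have "\<epsilon> * (ln (y i powr - \<gamma>) / \<epsilon>) \<le> \<epsilon> * (1 + of_int \<lfloor>ln (y i powr - \<gamma>) / \<epsilon>\<rfloor>)"
        using \<epsilon> by (intro mult_left_mono) linarith+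
      then have "exp (\<epsilon> * (ln (y i powr - \<gamma>) / \<epsilon>)) \<le> exp \<epsilon> * exp (\<epsilon> * of_int \<lfloor>ln (y i powr - \<gamma>) / \<epsilon>\<rfloor>)"
        by (simp add: distrib_left flip: exp_add)
      then show ?thesis
        using that floor[OF that] by (subst y_eq[OF that]) (simp add: w_def del: of_nat_nat)
    qed
    have "mean_load m n D (- \<gamma>) w k \<le> 1 * exp \<epsilon> * mean_load m n D (- \<gamma>) (\<lambda>i. y i powr - \<gamma>) k"
      using w_pos y_pos le ge that by (intro mean_load_perturb) (auto simp: less_imp_neq[symmetric])
    also have "\<dots> \<le> 1 * exp \<epsilon> * (exp (5 * \<epsilon>) * ?T)"
      using y_mean[OF that] by (intro mult_left_mono) auto
    also have "\<dots> = exp (6 * \<epsilon>) * ?T"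
      by (simp flip: exp_add mult.assoc)
    finally show ?thesis by (simp add: \<gamma>_def)
  qed
  ultimately show ?thesis by blast
qed

text \<open>With c = \<epsilon> / b the term ln m / c equals \<epsilon> T and the distortion is one
  more exp \<epsilon>. The chord bound exp (11 \<epsilon>) \<le> 1 + exp 11 \<epsilon> makes the
  loss linear in \<epsilon>.\<close>

lemma expectation_max_load_small_items:
  assumes m: "2 \<le> m" and \<epsilon>: "0 < \<epsilon>" "\<epsilon> < 1"
    and b: "b = expected_opt m n D / (ln (real m) / \<epsilon>\<^sup>2)" and T: "0 \<le> expected_opt m n D"
    and w: "\<And>i. i < m \<Longrightarrow> 0 < w i"
    and mean: "\<And>i. i < m \<Longrightarrow> mean_load m n D \<alpha> w i \<le> exp (10 * \<epsilon>) * expected_opt m n D"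
  shows "measure_pmf.expectation (instance_pmf n D) (\<lambda>P. max_load m n P (prop_alloc m P \<alpha> w))
    \<le> (1 + (1 + exp 11) * \<epsilon>) * expected_opt m n D"
proof -
  let ?T = "expected_opt m n D"
  have "measure_pmf.expectation (instance_pmf n D) (\<lambda>P. max_load m n P (prop_alloc m P \<alpha> w))
      \<le> ln (real m) / (\<epsilon> / b) + exp (\<epsilon> / b * b) * (exp (10 * \<epsilon>) * ?T)"
    using w mean \<epsilon> b_pos by (intro expectation_max_load_le) auto
  also have "ln (real m) / (\<epsilon> / b) = \<epsilon> * ?T"
    using m \<epsilon> by (simp add: b power2_eq_square)
  also have "exp (\<epsilon> / b * b) * (exp (10 * \<epsilon>) * ?T) = exp (11 * \<epsilon>) * ?T"
    using b_pos by (simp flip: exp_add mult.assoc)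
  also have "\<dots> \<le> (1 + exp 11 * \<epsilon>) * ?T"
    using exp_mult_le_affine[of \<epsilon> 11] \<epsilon> T by (intro mult_right_mono) auto
  finally show ?thesis by (simp add: algebra_simps)
qed

end

section \<open>Numerical estimates and the case without items\<close>

text \<open>With x = m / \<epsilon> \<ge> 2 the three factors are at most x, 2 x and x, and 2 x ^ 3
  + 1 \<le> x ^ 5. A polynomial bound is enough, as only its logarithm affects the sample
  size.\<close>

lemma net_size_le:
  fixes m :: nat and \<epsilon> :: real
  assumes m: "2 \<le> m" and \<epsilon>: "0 < \<epsilon>" "\<epsilon> < 1"
  shows "real (nat \<lfloor>(ln (real m) / \<epsilon> + 1) * ln (2 * real m / \<epsilon>) / \<epsilon>\<rfloor> + 1) \<le> (real m / \<epsilon>) ^ 5"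
proof -
  define x where "x = real m / \<epsilon>"
  have x: "real m \<le> x" "2 \<le> x" "1 / \<epsilon> \<le> x"
    using m \<epsilon> mult_mono[of 2 "real m" \<epsilon> 1] by (auto simp: x_def field_simps)
  have "ln (real m) / \<epsilon> \<le> (real m - 1) / \<epsilon>"
    using m \<epsilon> by (intro divide_right_mono ln_le_minus_one) auto
  also have "\<dots> \<le> x - 1"
    using \<epsilon> by (simp add: x_def field_simps)
  finally have \<gamma>: "ln (real m) / \<epsilon> + 1 \<le> x" by simp
  have ln: "ln (2 * real m / \<epsilon>) \<le> 2 * x"
    using ln_le_minus_one[of "2 * x"] x by (simp add: x_def)
  have "0 \<le> ln (2 * real m / \<epsilon>)" using x by (simp add: x_def)
  then have "(ln (real m) / \<epsilon> + 1) * ln (2 * real m / \<epsilon>) * (1 / \<epsilon>) \<le> x * (2 * x) * x"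
    using \<gamma> ln x m \<epsilon> by (intro mult_mono) auto
  then have "real (nat \<lfloor>(ln (real m) / \<epsilon> + 1) * ln (2 * real m / \<epsilon>) / \<epsilon>\<rfloor> + 1) \<le> x * (2 * x) * x + 1"
    using \<open>0 \<le> ln (2 * real m / \<epsilon>)\<close> m \<epsilon> by (simp add: of_nat_nat) linarith
  also have "\<dots> \<le> x * x ^ 3 + x ^ 3"
  proof -
    have "2 * x ^ 3 \<le> x * x ^ 3" "1 \<le> x ^ 3" using x by (auto intro!: mult_right_mono one_le_power)
    then show ?thesis by (simp add: power3_eq_cube)
  qed
  also have "\<dots> \<le> x * x ^ 3 + x * x ^ 3"
    using x by (intro add_left_mono) (auto simp: mult_le_cancel_right1)
  also have "\<dots> = 2 * x ^ 4" by (simp add: eval_nat_numeral)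
  also have "\<dots> \<le> x * x ^ 4" using x by (intro mult_right_mono) auto
  also have "\<dots> = x ^ 5" by (simp add: eval_nat_numeral)
  finally show ?thesis by (simp add: x_def)
qed

text \<open>With x = m / \<epsilon>, the exponential is at most x ^ (- 8 m), while the number of
  events is at most x ^ (5 m + 1). The spare 3 m \<ge> 2 powers of x leave a failure probability of
  at most 1 / x.\<close>

lemma failure_prob_le:
  fixes m N c :: nat and \<epsilon> :: real
  assumes m: "2 \<le> m" and \<epsilon>: "0 < \<epsilon>" "\<epsilon> < 1"
    and c: "real c \<le> ((real m / \<epsilon>) ^ 5) ^ m"
    and N: "8 * (real m / ln (real m)) * ln (real m / \<epsilon>) \<le> real N"
  shows "(real c + real m) * exp (- (real N * ln (real m))) \<le> 1 / real m"
proof -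
  define x where "x = real m / \<epsilon>"
  have x: "real m \<le> x" "2 \<le> x"
    using m \<epsilon> mult_mono[of 2 "real m" \<epsilon> 1] by (auto simp: x_def field_simps)
  have "8 * real m * ln x \<le> real N * ln (real m)"
    using mult_right_mono[OF N, of "ln (real m)"] m by (simp add: x_def)
  then have "exp (- (real N * ln (real m))) \<le> exp (- (real (8 * m) * ln x))"
    by simp
  also have "\<dots> = 1 / x ^ (8 * m)"
    unfolding exp_minus exp_of_nat_mult using x by (simp add: divide_inverse)
  finally have e: "exp (- (real N * ln (real m))) \<le> 1 / x ^ (8 * m)" .
  have "real m \<le> x ^ 1" using x by simp
  also have "\<dots> \<le> x ^ (5 * m)" using x m by (intro power_increasing) auto
  finally have "real c + real m \<le> 2 * x ^ (5 * m)"
    using c by (simp add: x_def power_mult)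
  also have "\<dots> \<le> x * x ^ (5 * m)" using x by (intro mult_right_mono) auto
  finally have "(real c + real m) * exp (- (real N * ln (real m))) * x \<le> (x * x ^ (5 * m)) * (1 / x ^ (8 * m)) * x"
    using e x by (intro mult_mono) auto
  also have "\<dots> = x ^ (5 * m + 2) / x ^ (8 * m)"
    by (simp add: power_add power2_eq_square)
  also have "\<dots> \<le> x ^ (8 * m) / x ^ (8 * m)"
    using x m by (intro divide_right_mono power_increasing) auto
  also have "\<dots> = 1"
    using x by simp
  finally have "(real c + real m) * exp (- (real N * ln (real m))) \<le> 1 / x"
    using x by (simp add: field_simps)
  also have "\<dots> \<le> 1 / real m"
    using x m by (intro divide_left_mono) auto
  finally show ?thesis .
qed

text \<open>Without items the small items assumption is vacuous and yields no positive entry bound,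
  so this case is settled directly.\<close>

lemma no_items:
  assumes "0 < m"
  shows "max_load m 0 P X = 0" "opt_mks m 0 P = 0" "expected_opt m 0 D = 0"
proof -
  have max: "max_load m 0 P X = 0" for P X
    using assms by (simp add: max_load_def load_def image_constant_conv lessThan_empty_iff)
  then show "max_load m 0 P X = 0" .
  have opt: "opt_mks m 0 P = 0" for P
    using feasible_uniform[OF assms, of 0] max by (auto simp: opt_mks_def image_constant_conv)
  then show "opt_mks m 0 P = 0" .
  show "expected_opt m 0 D = 0"
    using opt by (simp add: expected_opt_def cong: Bochner_Integration.integral_cong)
qed

text \<open>Rounding up costs at most 1, and 1 \<le> r because ln m \<le> m ln (m / \<epsilon>);
  hence 9 in place of 8.\<close>

lemma sample_size_bounds:
  fixes m :: nat and \<epsilon> :: real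
  defines "r \<equiv> real m / ln (real m) * ln (real m / \<epsilon>)"
  assumes m: "2 \<le> m" and \<epsilon>: "0 < \<epsilon>" "\<epsilon> < 1"
  shows "8 * r \<le> real (nat \<lceil>8 * r\<rceil>)" "real (nat \<lceil>8 * r\<rceil>) \<le> 9 * r"
proof -
  have "ln (real m) \<le> ln (real m / \<epsilon>)"
    using m \<epsilon> by (simp add: field_simps mult_le_cancel_left1)
  then have "1 * ln (real m) \<le> real m * ln (real m / \<epsilon>)"
    using m by (intro mult_mono) auto
  then have "1 \<le> r"
    using m by (simp add: r_def field_simps)
  then show "8 * r \<le> real (nat \<lceil>8 * r\<rceil>)" "real (nat \<lceil>8 * r\<rceil>) \<le> 9 * r"
    by linarith+
qed

theorem theorem6p2:
  shows "\<exists>C1 C2 C3 :: real. C1 > 0 \<and> C2 > 0 \<and> C3 > 0 \<and>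
    (\<forall>(m::nat) (\<epsilon>::real). m \<ge> 2 \<longrightarrow> 0 < \<epsilon> \<longrightarrow> \<epsilon> < 1 \<longrightarrow>
      (\<exists>(\<alpha>::real) (A::learner) (N::nat).
         real N \<le> C2 * (real m / ln (real m)) * ln (real m / \<epsilon>) \<and>
         (\<forall>(n::nat) D. D \<in> column_dists m n \<longrightarrow>
            small_items m n D (C1 * ln (real m) / \<epsilon>\<^sup>2) \<longrightarrow>
            measure_pmf.prob (learner_output A N n D)
              {w \<in> pos_vecs m.
                 measure_pmf.expectation (instance_pmf n D)
                   (\<lambda>P. max_load m n P (prop_alloc m P \<alpha> w))
                 \<le> (1 + C3 * \<epsilon>) * expected_opt m n D}
            \<ge> 1 - 1 / real m)))"
proof (rule exI[of _ 1], rule exI[of _ 9], rule exI[of _ "1 + exp 11"], intro conjI allI impI)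
  fix m :: nat and \<epsilon> :: real
  assume m: "2 \<le> m" and \<epsilon>: "0 < \<epsilon>" "\<epsilon> < 1"
  \<comment> \<open>This is \<open>- (\<beta> + 1)\<close> for \<beta> = ln m / \<epsilon>.
    Exponent, net and sample size depend on \<open>m\<close> and \<open>\<epsilon>\<close> only, and
    the learner is deterministic.\<close>
  define \<alpha> where "\<alpha> = - (ln (real m) / \<epsilon> + 1)"
  define K where "K = nat \<lfloor>(ln (real m) / \<epsilon> + 1) * ln (2 * real m / \<epsilon>) / \<epsilon>\<rfloor>"
  define W where "W = weight_net m \<epsilon> K"
  define A :: learner where "A = (\<lambda>n Ps. return_pmf (empirical_min m n \<alpha> W Ps))"
  define N where "N = nat \<lceil>8 * (real m / ln (real m) * ln (real m / \<epsilon>))\<rceil>"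
  have W: "finite W" "W \<noteq> {}" "W \<subseteq> pos_vecs m" "\<And>w i. w \<in> W \<Longrightarrow> i < m \<Longrightarrow> 0 < w i"
    using finite_weight_net weight_net_nonempty weight_net_subset weight_net_pos unfolding W_def by auto
  have "real (card W) \<le> real ((K + 1) ^ m)"
    using card_weight_net[of m \<epsilon> K] unfolding W_def of_nat_le_iff .
  also have "\<dots> \<le> ((real m / \<epsilon>) ^ 5) ^ m"
    using net_size_le[OF m \<epsilon>] unfolding of_nat_power K_def by (intro power_mono) auto
  finally have failure: "(real (card W) + real m) * exp (- (real N * ln (real m))) \<le> 1 / real m"
    using sample_size_bounds(1)[OF m \<epsilon>] m \<epsilon> unfolding N_def
    by (intro failure_prob_le[of m \<epsilon>]) (auto simp: mult.assoc)
  show "\<exists>\<alpha> A N. real N \<le> 9 * (real m / ln (real m)) * ln (real m / \<epsilon>) \<and>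
      (\<forall>n D. D \<in> column_dists m n \<longrightarrow> small_items m n D (1 * ln (real m) / \<epsilon>\<^sup>2) \<longrightarrow>
        measure_pmf.prob (learner_output A N n D)
          {w \<in> pos_vecs m. measure_pmf.expectation (instance_pmf n D)
             (\<lambda>P. max_load m n P (prop_alloc m P \<alpha> w)) \<le> (1 + (1 + exp 11) * \<epsilon>) * expected_opt m n D}
        \<ge> 1 - 1 / real m)"
  proof (rule exI[of _ \<alpha>], rule exI[of _ A], rule exI[of _ N], intro conjI allI impI)
    show "real N \<le> 9 * (real m / ln (real m)) * ln (real m / \<epsilon>)"
      using sample_size_bounds(2)[OF m \<epsilon>] by (simp add: N_def mult.assoc)
    fix n D
    assume D: "D \<in> column_dists m n" and small: "small_items m n D (1 * ln (real m) / \<epsilon>\<^sup>2)"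
    let ?T = "expected_opt m n D"
    let ?good = "{w \<in> pos_vecs m. measure_pmf.expectation (instance_pmf n D)
      (\<lambda>P. max_load m n P (prop_alloc m P \<alpha> w)) \<le> (1 + (1 + exp 11) * \<epsilon>) * ?T}"
    let ?prob = "measure_pmf.prob (replicate_pmf N (instance_pmf n D))"
    have out: "measure_pmf.prob (learner_output A N n D) ?good = ?prob {Ps. empirical_min m n \<alpha> W Ps \<in> ?good}"
      unfolding learner_output_def A_def by (simp add: vimage_def flip: map_pmf_def)
    have min_in: "empirical_min m n \<alpha> W Ps \<in> W" for Ps
      using W by (intro empirical_min_in)
    show "measure_pmf.prob (learner_output A N n D) ?good \<ge> 1 - 1 / real m"
    proof (cases "n = 0")
      case True
      then have "{Ps. empirical_min m n \<alpha> W Ps \<in> ?good} = UNIV"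
        using min_in W(3) m by (auto simp: no_items)
      then show ?thesis unfolding out by simp
    next
      case False
      define b where "b = ?T / (ln (real m) / \<epsilon>\<^sup>2)"
      have entry_le: "P i j \<le> b" if "P \<in> set_pmf (instance_pmf n D)" "i < m" "j < n" for P i j
        using small that unfolding small_items_def b_def mult_1 by blast
      \<comment> \<open>Some supported entry is positive and bounded by \<open>b\<close>. Hence T >
        0 as well, which excludes the default value 0 of a non-integrable optimum.\<close>
      have "0 < b"
      proof -
        obtain c where c: "c \<in> set_pmf (Pi_pmf {..<n} (\<lambda>_. undefined) D)"
          using set_pmf_not_empty[of "Pi_pmf {..<n} (\<lambda>_. undefined) D"] by blast
        then have "c 0 \<in> set_pmf (D 0)"
          using False by (simp add: set_Pi_pmf PiE_dflt_def)
        then have "c 0 \<in> pos_vecs m"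
          using D False unfolding column_dists_def by blast
        then have "0 < c 0 0" using m PiE_mem[of "c 0" "{..<m}" "\<lambda>_. {0<..}" 0] by (simp add: pos_vecs_def)
        also have "c 0 0 \<le> b"
        proof -
          have "(\<lambda>i j. c j i) \<in> set_pmf (instance_pmf n D)"
            unfolding instance_pmf_def set_map_pmf by (intro image_eqI[OF _ c]) simp
          from entry_le[OF this, of 0 0] show ?thesis using m False by simp
        qed
        finally show ?thesis .
      qed
      then interpret bounded_columns m n D b
        using m D entry_le by unfold_locales auto
      have T: "0 < ?T" "?T = b * ln (real m) / \<epsilon>\<^sup>2"
        using \<open>0 < b\<close> m \<epsilon> by (auto simp: b_def zero_less_divide_iff zero_less_mult_iff)
      obtain w0 where w0: "w0 \<in> W" "\<And>i. i < m \<Longrightarrow> mean_load m n D \<alpha> w0 i \<le> exp (6 * \<epsilon>) * ?T"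
        using ex_weight_net[OF m \<epsilon> T(1)] unfolding W_def K_def \<alpha>_def by blast
      \<comment> \<open>The exponent budget: 6 for the best net vector, 4 for learning from samples,
        and 1 more for the maximum on a fresh instance, which gives the 11 in the constant.\<close>
      have "1 - 1 / real m \<le> 1 - (real (card W) + real m) * exp (- (real N * ln (real m)))"
        using failure by simp
      also have "\<dots> \<le> ?prob {Ps. \<forall>i<m. mean_load m n D \<alpha> (empirical_min m n \<alpha> W Ps) i \<le> exp ((6 + 4) * \<epsilon>) * ?T}"
        using W T w0 \<epsilon> by (intro empirical_min_correct) auto
      also have "\<dots> \<le> ?prob {Ps. empirical_min m n \<alpha> W Ps \<in> ?good}"
      proof (intro measure_pmf.finite_measure_mono subsetI)
        fix Ps
        assume Ps: "Ps \<in> {Ps. \<forall>i<m. mean_load m n D \<alpha> (empirical_min m n \<alpha> W Ps) i \<le> exp ((6 + 4) * \<epsilon>) * ?T}"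
        have "measure_pmf.expectation (instance_pmf n D)
            (\<lambda>P. max_load m n P (prop_alloc m P \<alpha> (empirical_min m n \<alpha> W Ps))) \<le> (1 + (1 + exp 11) * \<epsilon>) * ?T"
          using Ps W(4)[OF min_in] T(1) b_def m \<epsilon> by (intro expectation_max_load_small_items) auto
        then show "Ps \<in> {Ps. empirical_min m n \<alpha> W Ps \<in> ?good}"
          using min_in W(3) by auto
      qed simp
      finally show ?thesis unfolding out .
    qed
  qed
qed (auto simp: add_pos_pos)

end
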